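(* Let $\mathsf V$ be the variety of all $\ell$-groups (respectively, the variety of representable $\ell$-groups, or the variety of Abelian $\ell$-groups). For any partially ordered group $G$, the minimal spectrum $\mathrm{Min}\,F_{\mathsf V}(G)$ is compact.
   Context: A partially ordered group is a group $G$ (identity $\mathrm{e}$) with a partial order such that $a\le b$ implies $sat\le sbt$. An $\ell$-group is a partially ordered group whose order is a lattice; it is representable if it is a subdirect product of totally ordered groups, and Abelian if its group is Abelian. An $\ell$-homomorphism is a group and lattice homomorphism; a positive homomorphism is an order-preserving group homomorphism. $F_{\mathsf V}(G)$, with positive homomorphism $\eta\colon G\to F_{\mathsf V}(G)$, is the free $\ell$-group over $G$ in $\mathsf V$: $F_{\mathsf V}(G)\in\mathsf V$ and for each positive homomorphism $p\colon G\to H$ with $H\in\mathsf V$ there is exactly one $\ell$-homomorphism $h$ with $h\circ\eta=p$ (the map $\eta$ need not be injective). For an $\ell$-group $H$, a convex $\ell$-subgroup is an order-convex sublattice subgroup $\mathfrak k$; cosets are ordered by $\mathfrak kx\le\mathfrak ky$ iff $x\le ty$ for some $t\in\mathfrak k$; $\mathfrak k$ is prime if it is proper and $H/\mathfrak k$ is totally ordered. $\mathrm{Spec}\,H$ is the set of prime subgroups with open sets $\{\mathfrak p\mid A\not\subseteq\mathfrak p\}$, $A\subseteq H$. $\mathrm{Min}\,H$ is the subspace of inclusion-minimal prime subgroups. *)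

theory Defs
  imports "HOL-Algebra.Coset" "HOL-Analysis.Abstract_Topology"
begin

section \<open>Partially ordered groups and lattice-ordered groups\<close>

record 'a pogroup = "'a monoid" +
  leq :: "'a \<Rightarrow> 'a \<Rightarrow> bool" (infixl "\<preceq>\<index>" 50)

definition poset_of :: "('a, 'm) pogroup_scheme \<Rightarrow> 'a gorder" where
  "poset_of G = \<lparr>carrier = carrier G, eq = (=), le = leq G\<rparr>"

locale po_group = group G + po: Order.partial_order "poset_of G"
  for G :: "('a, 'm) pogroup_scheme" (structure) +
  assumes translate:
    "\<lbrakk>a \<in> carrier G; b \<in> carrier G; s \<in> carrier G; t \<in> carrier G; a \<preceq> b\<rbrakk>
      \<Longrightarrow> s \<otimes> a \<otimes> t \<preceq> s \<otimes> b \<otimes> t"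

locale l_group = po_group G + lat: Lattice.lattice "poset_of G"
  for G :: "('a, 'm) pogroup_scheme" (structure)

locale o_group = po_group G + tot: Order.total_order "poset_of G"
  for G :: "('a, 'm) pogroup_scheme" (structure)

definition positive_hom :: "('a, 'm) pogroup_scheme \<Rightarrow> ('b, 'n) pogroup_scheme \<Rightarrow> ('a \<Rightarrow> 'b) set" where
  "positive_hom G H = {p \<in> hom G H. isotone (poset_of G) (poset_of H) p}"

definition l_hom :: "('a, 'm) pogroup_scheme \<Rightarrow> ('b, 'n) pogroup_scheme \<Rightarrow> ('a \<Rightarrow> 'b) set" where
  "l_hom G H = {h \<in> hom G H.
     join_pres (poset_of G) (poset_of H) h \<and> meet_pres (poset_of G) (poset_of H) h}"


section \<open>The three varieties\<close>

text \<open>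
  A subdirect representation is given by its coordinate maps: jointly injective surjective
  \<open>\<ell>\<close>-homomorphisms onto totally ordered groups. Up to isomorphism every factor is a quotient of
  \<open>H\<close> and repeated kernels are redundant, so index sets and factors carried by \<^typ>\<open>'a set\<close> suffice.
\<close>

definition representable :: "('a, 'm) pogroup_scheme \<Rightarrow> bool" where
  "representable H \<longleftrightarrow> l_group H \<and>
     (\<exists>(I :: 'a set set) (K :: 'a set \<Rightarrow> 'a set pogroup) (\<pi> :: 'a set \<Rightarrow> 'a \<Rightarrow> 'a set).
        (\<forall>i\<in>I. o_group (K i) \<and> \<pi> i \<in> l_hom H (K i) \<and> \<pi> i ` carrier H = carrier (K i)) \<and>
        (\<forall>x\<in>carrier H. \<forall>y\<in>carrier H. (\<forall>i\<in>I. \<pi> i x = \<pi> i y) \<longrightarrow> x = y))"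

text \<open>
  A variety has to be applied to \<open>\<ell>\<close>-groups over different carrier types, which a bound
  predicate variable cannot do; hence names for the three varieties.
\<close>

datatype variety = All_l_groups | Representable_l_groups | Abelian_l_groups

fun in_variety :: "variety \<Rightarrow> ('a, 'm) pogroup_scheme \<Rightarrow> bool" where
  "in_variety All_l_groups H = l_group H"
| "in_variety Representable_l_groups H = representable H"
| "in_variety Abelian_l_groups H = (l_group H \<and> comm_group H)"


section \<open>Free lattice-ordered groups over a partially ordered group\<close>

text \<open>
  HOL cannot quantify over all carrier types, so the test objects \<open>H\<close> below are carried by one
  fixed type. It is infinite and contains copies of \<^typ>\<open>'g\<close> and \<^typ>\<open>'f\<close>, hence the universal
  property for it already implies the one for every type: existence only needs the
  \<open>\<ell>\<close>-subgroup of \<open>H\<close> generated by the image of \<open>p\<close>, whose cardinality is at most that of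
  \<^typ>\<open>'g + nat\<close>, and then uniqueness follows from uniqueness for \<open>H = F\<close> (\<open>F\<close> retracts onto, and
  therefore equals, the \<open>\<ell>\<close>-subgroup generated by the image of \<open>\<eta>\<close>). Functions on the sum type leave
  room for automorphism groups of chains built from \<open>G\<close> or \<open>F\<close>.
  Uniqueness of \<open>h\<close> is understood on the carrier of \<open>F\<close>, whence \<^const>\<open>extensional\<close>.
\<close>

type_synonym ('g, 'f) test = "('g + 'f + nat) \<Rightarrow> ('g + 'f + nat)"

definition free_l_group_over :: "variety \<Rightarrow> 'g pogroup \<Rightarrow> 'f pogroup \<Rightarrow> ('g \<Rightarrow> 'f) \<Rightarrow> bool" where
  "free_l_group_over V G F \<eta> \<longleftrightarrow>
     in_variety V F \<and> \<eta> \<in> positive_hom G F \<and>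
     (\<forall>(H :: ('g, 'f) test pogroup) p. in_variety V H \<and> p \<in> positive_hom G H \<longrightarrow>
        (\<exists>!h. h \<in> l_hom F H \<inter> extensional (carrier F) \<and> (\<forall>x\<in>carrier G. h (\<eta> x) = p x)))"


section \<open>Prime subgroups and the spectral space\<close>

definition convex_l_subgroup :: "'a set \<Rightarrow> ('a, 'm) pogroup_scheme \<Rightarrow> bool" where
  "convex_l_subgroup K H \<longleftrightarrow> subgroup K H \<and>
     (\<forall>x\<in>K. \<forall>y\<in>K. x \<squnion>\<^bsub>poset_of H\<^esub> y \<in> K \<and> x \<sqinter>\<^bsub>poset_of H\<^esub> y \<in> K) \<and>
     (\<forall>x\<in>K. \<forall>y\<in>K. \<forall>z\<in>carrier H. x \<preceq>\<^bsub>H\<^esub> z \<and> z \<preceq>\<^bsub>H\<^esub> y \<longrightarrow> z \<in> K)"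

definition coset_poset :: "('a, 'm) pogroup_scheme \<Rightarrow> 'a set \<Rightarrow> 'a set gorder" where
  "coset_poset H K = \<lparr>carrier = rcosets\<^bsub>H\<^esub> K, eq = (=),
     le = (\<lambda>A B. \<exists>x\<in>carrier H. \<exists>y\<in>carrier H. A = K #>\<^bsub>H\<^esub> x \<and> B = K #>\<^bsub>H\<^esub> y \<and>
                  (\<exists>t\<in>K. x \<preceq>\<^bsub>H\<^esub> t \<otimes>\<^bsub>H\<^esub> y))\<rparr>"

definition prime_subgroup :: "'a set \<Rightarrow> ('a, 'm) pogroup_scheme \<Rightarrow> bool" where
  "prime_subgroup P H \<longleftrightarrow>
     convex_l_subgroup P H \<and> P \<noteq> carrier H \<and> Order.total_order (coset_poset H P)"

definition Spec :: "('a, 'm) pogroup_scheme \<Rightarrow> 'a set set" where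
  "Spec H = {P. prime_subgroup P H}"

definition spec_topology :: "('a, 'm) pogroup_scheme \<Rightarrow> 'a set topology" where
  "spec_topology H = topology (\<lambda>U. \<exists>A\<subseteq>carrier H. U = {P \<in> Spec H. \<not> A \<subseteq> P})"

definition Min_Spec :: "('a, 'm) pogroup_scheme \<Rightarrow> 'a set set" where
  "Min_Spec H = {P \<in> Spec H. \<forall>Q\<in>Spec H. Q \<subseteq> P \<longrightarrow> Q = P}"

definition min_spec_topology :: "('a, 'm) pogroup_scheme \<Rightarrow> 'a set topology" where
  "min_spec_topology H = subtopology (spec_topology H) (Min_Spec H)"


text \<open>The sets in \<^const>\<open>spec_topology\<close> do form a topology.\<close>

context l_group
begin

abbreviation jn (infixl "\<or>\<^sub>l" 65) where "x \<or>\<^sub>l y \<equiv> x \<squnion>\<^bsub>poset_of G\<^esub> y"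
abbreviation mt (infixl "\<and>\<^sub>l" 65) where "x \<and>\<^sub>l y \<equiv> x \<sqinter>\<^bsub>poset_of G\<^esub> y"

lemma carrier_poset_of: "carrier (poset_of G) = carrier G"
  by (simp add: poset_of_def)

lemma le_poset_of: "le (poset_of G) = leq G"
  by (simp add: poset_of_def)

lemmas leq_refl = po.le_refl[unfolded carrier_poset_of le_poset_of]
  and leq_trans = po.le_trans[unfolded carrier_poset_of le_poset_of]
  and jn_closed = lat.join_closed[unfolded carrier_poset_of]
  and mt_closed = lat.meet_closed[unfolded carrier_poset_of]
  and jn_left = lat.join_left[unfolded carrier_poset_of le_poset_of]
  and jn_right = lat.join_right[unfolded carrier_poset_of le_poset_of]
  and mt_left = lat.meet_left[unfolded carrier_poset_of le_poset_of]
  and mt_right = lat.meet_right[unfolded carrier_poset_of le_poset_of]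
  and mt_greatest = lat.meet_le[unfolded carrier_poset_of le_poset_of]

lemma translate_left:
  assumes "a \<in> carrier G" "b \<in> carrier G" "s \<in> carrier G" "a \<preceq> b"
  shows "s \<otimes> a \<preceq> s \<otimes> b"
  using translate[of a b s \<one>] assms by simp

lemma translate_right:
  assumes "a \<in> carrier G" "b \<in> carrier G" "s \<in> carrier G" "a \<preceq> b"
  shows "a \<otimes> s \<preceq> b \<otimes> s"
  using translate[of a b \<one> s] assms by simp

lemma convexD:
  assumes "convex_l_subgroup P G" "x \<in> P" "y \<in> P" "z \<in> carrier G" "x \<preceq> z" "z \<preceq> y"
  shows "z \<in> P"
  using assms(1)[unfolded convex_l_subgroup_def] assms(2-) by (elim conjE) blast

lemma convex_subgroup: "convex_l_subgroup P G \<Longrightarrow> subgroup P G"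
  unfolding convex_l_subgroup_def by (elim conjE)

lemma convex_jn:
  assumes "convex_l_subgroup P G" "x \<in> P" "y \<in> P"
  shows "x \<or>\<^sub>l y \<in> P"
  using assms(1)[unfolded convex_l_subgroup_def] assms(2-) by (elim conjE) blast

lemma prime_convex: "prime_subgroup P G \<Longrightarrow> convex_l_subgroup P G"
  unfolding prime_subgroup_def by (elim conjE)

lemma inv_jn_le:
  assumes a: "a \<in> carrier G"
  shows "inv (inv a \<or>\<^sub>l \<one>) \<preceq> a"
proof -
  let ?n = "inv a \<or>\<^sub>l \<one>"
  have n: "?n \<in> carrier G" using a by (simp add: jn_closed)
  have "inv a \<preceq> ?n" using a by (simp add: jn_left)
  then have "a \<otimes> inv a \<otimes> inv ?n \<preceq> a \<otimes> ?n \<otimes> inv ?n"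
    using a n by (intro translate) auto
  then show ?thesis using a n by (simp add: m_assoc)
qed

lemma parts_in_imp:
  assumes P: "convex_l_subgroup P G" and a: "a \<in> carrier G"
    and pos: "a \<or>\<^sub>l \<one> \<in> P" and neg: "inv a \<or>\<^sub>l \<one> \<in> P"
  shows "a \<in> P"
proof -
  have "inv (inv a \<or>\<^sub>l \<one>) \<in> P"
    by (rule subgroup.m_inv_closed[OF convex_subgroup[OF P] neg])
  then show ?thesis
    by (rule convexD[OF P _ pos a inv_jn_le[OF a] jn_left[OF a one_closed]])
qed

lemma parts_not_in:
  assumes P: "convex_l_subgroup P G" and a: "a \<in> carrier G" "a \<notin> P"
  obtains c where "c \<in> {a \<or>\<^sub>l \<one>, inv a \<or>\<^sub>l \<one>}" "c \<in> carrier G" "c \<notin> P" "\<one> \<preceq> c"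
proof -
  from parts_in_imp[OF P a(1)] a(2)
  obtain c where "c \<in> {a \<or>\<^sub>l \<one>, inv a \<or>\<^sub>l \<one>}" "c \<notin> P" by blast
  moreover from this a(1) have "c \<in> carrier G" "\<one> \<preceq> c"
    by (auto simp: jn_closed jn_right)
  ultimately show ?thesis by (intro that)
qed

lemma parts_in:
  assumes P: "convex_l_subgroup P G" and a: "a \<in> P"
  shows "a \<or>\<^sub>l \<one> \<in> P" "inv a \<or>\<^sub>l \<one> \<in> P"
proof -
  note sub = convex_subgroup[OF P]
  show "a \<or>\<^sub>l \<one> \<in> P" "inv a \<or>\<^sub>l \<one> \<in> P"
    by (rule convex_jn[OF P _ subgroup.one_closed[OF sub]],
        rule a subgroup.m_inv_closed[OF sub a])+
qed

lemma prime_meet_aux: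
  assumes P: "convex_l_subgroup P G"
    and c: "c \<in> carrier G" "\<one> \<preceq> c" and d: "d \<in> carrier G" "\<one> \<preceq> d"
    and m: "c \<and>\<^sub>l d \<in> P" and t: "t \<in> P" "c \<preceq> t \<otimes> d"
  shows "c \<in> P"
proof -
  have sub: "subgroup P G" by (rule convex_subgroup[OF P])
  then have e: "\<one> \<in> P" by (rule subgroup.one_closed)
  define u where "u = t \<or>\<^sub>l \<one>"
  have uP: "u \<in> P" using parts_in(1)[OF P t(1)] by (simp add: u_def)
  have tG: "t \<in> carrier G" and uG: "u \<in> carrier G"
    using sub t(1) uP by (auto dest: subgroup.mem_carrier)
  have tu: "t \<preceq> u" and eu: "\<one> \<preceq> u" using tG by (auto simp: u_def jn_left jn_right)
  have "t \<otimes> d \<preceq> u \<otimes> d" using tG uG d tu by (intro translate_right)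
  then have cud: "c \<preceq> u \<otimes> d" using leq_trans[OF t(2)] tG uG d c by simp
  have uc: "inv u \<otimes> c \<preceq> d"
    using translate_left[OF c(1) _ _ cud, of "inv u"] uG d by (simp add: m_assoc[symmetric])
  have "inv u \<otimes> \<one> \<preceq> inv u \<otimes> u" using uG eu by (intro translate_left) auto
  then have "inv u \<preceq> \<one>" using uG by simp
  then have "inv u \<otimes> c \<preceq> \<one> \<otimes> c" using uG c by (intro translate_right) auto
  then have "inv u \<otimes> c \<preceq> c \<and>\<^sub>l d" using uG c d uc by (intro mt_greatest) auto
  then have "u \<otimes> (inv u \<otimes> c) \<preceq> u \<otimes> (c \<and>\<^sub>l d)"
    using uG c d by (intro translate_left) (auto simp: mt_closed)
  then have "c \<preceq> u \<otimes> (c \<and>\<^sub>l d)" using uG c by (simp add: m_assoc[symmetric])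
  moreover have "u \<otimes> (c \<and>\<^sub>l d) \<in> P" using sub uP m by (rule subgroup.m_closed)
  ultimately show ?thesis using convexD[OF P e _ c(1) c(2)] by simp
qed

lemma coset_le_repr:
  assumes P: "subgroup P G" and c: "c \<in> carrier G" and d: "d \<in> carrier G"
    and le: "le (coset_poset G P) (P #> c) (P #> d)"
  shows "\<exists>t\<in>P. c \<preceq> t \<otimes> d"
proof -
  obtain x y t where x: "x \<in> carrier G" and y: "y \<in> carrier G"
    and cx: "P #> c = P #> x" and dy: "P #> d = P #> y" and t: "t \<in> P" "x \<preceq> t \<otimes> y"
    using le by (auto simp: coset_poset_def)
  have "c \<in> P #> x" using rcos_self[OF c P] cx by simp
  then obtain k where k: "k \<in> P" "c = k \<otimes> x" by (auto simp: r_coset_def)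
  have "y \<in> P #> d" using rcos_self[OF y P] dy by simp
  then obtain l where l: "l \<in> P" "y = l \<otimes> d" by (auto simp: r_coset_def)
  note G = subgroup.mem_carrier[OF P]
  have "k \<otimes> x \<preceq> k \<otimes> (t \<otimes> y)" using x y t k G by (intro translate_left) auto
  then have "c \<preceq> (k \<otimes> t \<otimes> l) \<otimes> d" using k l t d G by (simp add: m_assoc)
  then show ?thesis using P k l t by (blast intro: subgroup.m_closed)
qed

lemma prime_meet:
  assumes P: "prime_subgroup P G"
    and c: "c \<in> carrier G" "\<one> \<preceq> c" and d: "d \<in> carrier G" "\<one> \<preceq> d"
    and m: "c \<and>\<^sub>l d \<in> P"
  shows "c \<in> P \<or> d \<in> P"
proof -
  have conv: "convex_l_subgroup P G" and tot: "Order.total_order (coset_poset G P)"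
    using P unfolding prime_subgroup_def by blast+
  have sub: "subgroup P G" by (rule convex_subgroup[OF conv])
  have "P #> c \<in> carrier (coset_poset G P)" "P #> d \<in> carrier (coset_poset G P)"
    using c d by (auto simp: coset_poset_def RCOSETS_def)
  then consider "le (coset_poset G P) (P #> c) (P #> d)" | "le (coset_poset G P) (P #> d) (P #> c)"
    using Order.total_order.total_order_total[OF tot] by blast
  then show ?thesis
  proof cases
    case 1
    then show ?thesis using coset_le_repr[OF sub c(1) d(1)] prime_meet_aux[OF conv c d m] by blast
  next
    case 2
    then show ?thesis using coset_le_repr[OF sub d(1) c(1)] prime_meet_aux[OF conv d c] m
      by (auto simp: meet_comm)
  qed
qed

lemma istopology_spec: "istopology (\<lambda>U. \<exists>A\<subseteq>carrier G. U = {P \<in> Spec G. \<not> A \<subseteq> P})"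
  unfolding istopology_def
proof (intro conjI allI impI)
  fix S T
  assume S: "\<exists>A\<subseteq>carrier G. S = {P \<in> Spec G. \<not> A \<subseteq> P}"
    and T: "\<exists>B\<subseteq>carrier G. T = {P \<in> Spec G. \<not> B \<subseteq> P}"
  from S obtain A where A: "A \<subseteq> carrier G" "S = {P \<in> Spec G. \<not> A \<subseteq> P}"
    by (elim exE conjE)
  from T obtain B where B: "B \<subseteq> carrier G" "T = {P \<in> Spec G. \<not> B \<subseteq> P}"
    by (elim exE conjE)
  define parts where "parts = (\<lambda>X. \<Union>a\<in>X. {a \<or>\<^sub>l \<one>, inv a \<or>\<^sub>l \<one>})"
  define C where "C = {c \<and>\<^sub>l d | c d. c \<in> parts A \<and> d \<in> parts B}"
  have pc: "c \<in> carrier G" "\<one> \<preceq> c" if "X \<subseteq> carrier G" "c \<in> parts X" for X c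
    using that by (auto simp: parts_def subset_iff jn_closed jn_right)
  have C: "C \<subseteq> carrier G" using pc(1)[OF A(1)] pc(1)[OF B(1)] by (auto simp: C_def mt_closed)
  have part: "\<exists>c\<in>parts X. c \<notin> P" if "convex_l_subgroup P G" "X \<subseteq> carrier G" "\<not> X \<subseteq> P" for X P
  proof -
    obtain a where a: "a \<in> X" "a \<in> carrier G" "a \<notin> P" using \<open>X \<subseteq> carrier G\<close> \<open>\<not> X \<subseteq> P\<close> by blast
    obtain c where "c \<in> {a \<or>\<^sub>l \<one>, inv a \<or>\<^sub>l \<one>}" "c \<notin> P"
      by (rule parts_not_in[OF \<open>convex_l_subgroup P G\<close> a(2,3)])
    with a(1) show ?thesis unfolding parts_def by blast
  qed
  have sub: "c \<in> P" if "convex_l_subgroup P G" "X \<subseteq> P" "c \<in> parts X" for X P c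
    using that(3) parts_in[OF that(1) subsetD[OF that(2)]] by (auto simp: parts_def)
  have "\<not> C \<subseteq> P \<longleftrightarrow> \<not> A \<subseteq> P \<and> \<not> B \<subseteq> P" if "P \<in> Spec G" for P
  proof -
    have pr: "prime_subgroup P G" using that by (simp add: Spec_def)
    then have conv: "convex_l_subgroup P G" by (rule prime_convex)
    have e: "\<one> \<in> P" by (rule subgroup.one_closed[OF convex_subgroup[OF conv]])
    show ?thesis
    proof
      assume "\<not> C \<subseteq> P"
      then obtain c d where cd: "c \<in> parts A" "d \<in> parts B" "c \<and>\<^sub>l d \<notin> P"
        by (auto simp: C_def)
      note c = pc[OF A(1) cd(1)] and d = pc[OF B(1) cd(2)]
      have "\<one> \<preceq> c \<and>\<^sub>l d" using c d by (intro mt_greatest) auto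
      then have "c \<notin> P" "d \<notin> P"
        using convexD[OF conv e _ mt_closed[OF c(1) d(1)]] cd(3) mt_left[OF c(1) d(1)]
          mt_right[OF c(1) d(1)] by auto
      then show "\<not> A \<subseteq> P \<and> \<not> B \<subseteq> P" using sub[OF conv] cd by blast
    next
      assume "\<not> A \<subseteq> P \<and> \<not> B \<subseteq> P"
      then obtain c d where cd: "c \<in> parts A" "c \<notin> P" "d \<in> parts B" "d \<notin> P"
        using part[OF conv A(1)] part[OF conv B(1)] by blast
      then have "c \<and>\<^sub>l d \<notin> P"
        using prime_meet[OF pr pc[OF A(1) cd(1)] pc[OF B(1) cd(3)]] by blast
      then show "\<not> C \<subseteq> P" using cd by (auto simp: C_def)
    qed
  qed
  then have "S \<inter> T = {P \<in> Spec G. \<not> C \<subseteq> P}"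
    unfolding A(2) B(2) by blast
  then show "\<exists>A\<subseteq>carrier G. S \<inter> T = {P \<in> Spec G. \<not> A \<subseteq> P}" using C by (intro exI conjI)
next
  fix \<K>
  define D where "D = (\<lambda>A. {P \<in> Spec G. \<not> A \<subseteq> P})"
  assume "\<forall>K\<in>\<K>. \<exists>A\<subseteq>carrier G. K = {P \<in> Spec G. \<not> A \<subseteq> P}"
  then have \<K>: "\<exists>A\<subseteq>carrier G. K = D A" if "K \<in> \<K>" for K
    using that unfolding D_def by (rule bspec)
  define \<A> where "\<A> = {A. A \<subseteq> carrier G \<and> D A \<in> \<K>}"
  have "K \<in> D ` \<A>" if "K \<in> \<K>" for K
  proof -
    from \<K>[OF that] obtain A where "A \<subseteq> carrier G" "K = D A" by (elim exE conjE)
    with that show ?thesis by (simp add: \<A>_def)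
  qed
  then have "\<K> = D ` \<A>" by (auto simp: \<A>_def)
  moreover have "\<Union>(D ` \<A>) = D (\<Union>\<A>)" by (auto simp: D_def)
  ultimately have "\<Union>\<K> = D (\<Union>\<A>)" by simp
  moreover have "\<Union>\<A> \<subseteq> carrier G" by (auto simp: \<A>_def)
  ultimately show "\<exists>A\<subseteq>carrier G. \<Union>\<K> = {P \<in> Spec G. \<not> A \<subseteq> P}"
    unfolding D_def by (intro exI conjI)
qed

lemma openin_spec_topology:
  "openin (spec_topology G) U \<longleftrightarrow> (\<exists>A\<subseteq>carrier G. U = {P \<in> Spec G. \<not> A \<subseteq> P})"
  by (simp add: spec_topology_def topology_inverse'[OF istopology_spec])

end

end

theory Submission
  imports Defs "HOL-Analysis.Function_Topology"
begin

text \<open>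
  A prime subgroup \<open>P\<close> of \<open>F\<close> is the same as the total right invariant preorder \<open>P x \<le> P y\<close>. Since
  \<open>\<eta>(G)\<close> generates \<open>F\<close> as a lattice, this preorder is determined by its restriction to \<open>\<eta>(G)\<close>,
  and refining the restriction shrinks \<open>P\<close>. Conversely, a right preorder on \<open>G\<close> lifts to \<open>F\<close>:
  let \<open>G\<close> act on the chain of its equivalence classes, extend the action to \<open>F\<close> by freeness, and compare
  the images of the class of the identity.

  Hence \<open>P\<close> is minimal iff \<open>P\<close> meets \<open>\<eta>(G)\<close> only in the identity. If the preorder of \<open>P\<close> is antisymmetric
  on \<open>\<eta>(G)\<close>, then it cannot be refined there; and if \<open>P\<close> contains some \<open>\<eta>(c) \<noteq> \<one>\<close>, then its preorder
  can be refined lexicographically by that of a prime omitting \<open>\<eta>(c)\<close>, which gives a smaller prime. In the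
  representable and Abelian cases the refinement has to be left invariant as well, which holds because
  minimal primes are normal: every prime contains one that comes from a maximal filter of positive
  elements, and orthogonality is preserved by conjugation. The preorders on \<open>F\<close> whose kernel meets
  \<open>\<eta>(G)\<close> trivially form a closed subset of the compact space of binary relations, and the minimal
  spectrum is its image under the continuous map that sends a preorder to its kernel.
\<close>

section \<open>Lattice-ordered groups\<close>

lemma carrier_poset_of [simp]: "carrier (poset_of G) = carrier G"
  by (simp add: poset_of_def)

lemma le_poset_of [simp]: "le (poset_of G) = leq G"
  by (simp add: poset_of_def)

lemma eq_poset_of [simp]: "eq (poset_of G) = (=)"
  by (simp add: poset_of_def)

context po_group
begin

lemmas leq_refl = po.le_refl[unfolded carrier_poset_of le_poset_of]
  and leq_trans = po.le_trans[unfolded carrier_poset_of le_poset_of]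
  and leq_antisym = po.le_antisym[unfolded carrier_poset_of le_poset_of]

lemma inv_le:
  assumes "x \<in> carrier G" "y \<in> carrier G" "x \<preceq> y"
  shows "inv y \<preceq> inv x"
proof -
  have "inv y \<otimes> x \<otimes> inv x \<preceq> inv y \<otimes> y \<otimes> inv x"
    using assms by (intro translate) auto
  then show ?thesis using assms by (simp add: m_assoc)
qed

end

lemma po_groupI:
  fixes G (structure)
  assumes "group G"
    and "\<And>x. x \<in> carrier G \<Longrightarrow> x \<preceq> x"
    and "\<And>x y. \<lbrakk>x \<in> carrier G; y \<in> carrier G; x \<preceq> y; y \<preceq> x\<rbrakk> \<Longrightarrow> x = y"
    and "\<And>x y z. \<lbrakk>x \<in> carrier G; y \<in> carrier G; z \<in> carrier G; x \<preceq> y; y \<preceq> z\<rbrakk> \<Longrightarrow> x \<preceq> z"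
    and "\<And>a b s. \<lbrakk>a \<in> carrier G; b \<in> carrier G; s \<in> carrier G; a \<preceq> b\<rbrakk> \<Longrightarrow> s \<otimes> a \<preceq> s \<otimes> b"
    and "\<And>a b s. \<lbrakk>a \<in> carrier G; b \<in> carrier G; s \<in> carrier G; a \<preceq> b\<rbrakk> \<Longrightarrow> a \<otimes> s \<preceq> b \<otimes> s"
  shows "po_group G"
proof -
  interpret group G by fact
  show ?thesis
  proof unfold_locales
    fix x y z
    assume *: "x \<in> carrier (poset_of G)" "y \<in> carrier (poset_of G)" "z \<in> carrier (poset_of G)"
    show "le (poset_of G) x y \<Longrightarrow> le (poset_of G) y x \<Longrightarrow> eq (poset_of G) x y"
      using assms(3)[of x y] * by simp
    show "le (poset_of G) x y \<Longrightarrow> le (poset_of G) y z \<Longrightarrow> le (poset_of G) x z"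
      using assms(4)[of x y z] * by simp
  next
    fix a b s t
    assume *: "a \<in> carrier G" "b \<in> carrier G" "s \<in> carrier G" "t \<in> carrier G" "a \<preceq> b"
    show "s \<otimes> a \<otimes> t \<preceq> s \<otimes> b \<otimes> t"
      by (rule assms(6)[OF _ _ _ assms(5)]) (use * in simp_all)
  qed (use assms(2) in simp_all)
qed

text \<open>Joins suffice: inversion reverses the order, so the inverse of a join of
  \<open>inv x\<close> and \<open>inv y\<close> is a meet of \<open>x\<close> and
  \<open>y\<close>.\<close>

lemma l_groupI:
  fixes G (structure)
  assumes po: "po_group G"
    and sup: "\<And>x y. \<lbrakk>x \<in> carrier G; y \<in> carrier G\<rbrakk> \<Longrightarrow>
      \<exists>s\<in>carrier G. x \<preceq> s \<and> y \<preceq> s \<and> (\<forall>z\<in>carrier G. x \<preceq> z \<and> y \<preceq> z \<longrightarrow> s \<preceq> z)"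
  shows "l_group G"
proof -
  interpret po_group G by fact
  show ?thesis
  proof unfold_locales
    fix x y assume "x \<in> carrier (poset_of G)" "y \<in> carrier (poset_of G)"
    then have xy: "x \<in> carrier G" "y \<in> carrier G" by simp_all
    obtain s where "s \<in> carrier G" "x \<preceq> s" "y \<preceq> s" "\<forall>z\<in>carrier G. x \<preceq> z \<and> y \<preceq> z \<longrightarrow> s \<preceq> z"
      using sup[OF xy] by blast
    then have "least (poset_of G) s (Upper (poset_of G) {x, y})"
      using xy by (intro least_UpperI) (auto simp: Upper_def)
    then show "\<exists>s. least (poset_of G) s (Upper (poset_of G) {x, y})" ..
    obtain s where s: "s \<in> carrier G" "inv x \<preceq> s" "inv y \<preceq> s"
      "\<forall>z\<in>carrier G. inv x \<preceq> z \<and> inv y \<preceq> z \<longrightarrow> s \<preceq> z"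
      using sup[of "inv x" "inv y"] xy by auto
    have "inv s \<preceq> x" "inv s \<preceq> y"
      using inv_le[of "inv x" s] inv_le[of "inv y" s] s xy by auto
    moreover have "z \<preceq> inv s" if "z \<in> carrier G" "z \<preceq> x" "z \<preceq> y" for z
      using inv_le[of s "inv z"] s(1,4) inv_le[OF that(1) _ that(2)] inv_le[OF that(1) _ that(3)]
        that xy by auto
    ultimately have "greatest (poset_of G) (inv s) (Lower (poset_of G) {x, y})"
      using xy s by (intro greatest_LowerI) (auto simp: Lower_def)
    then show "\<exists>s. greatest (poset_of G) s (Lower (poset_of G) {x, y})" ..
  qed
qed

lemma o_groupI:
  fixes G (structure)
  assumes "po_group G"
    and "\<And>x y. \<lbrakk>x \<in> carrier G; y \<in> carrier G\<rbrakk> \<Longrightarrow> x \<preceq> y \<or> y \<preceq> x"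
  shows "o_group G"
proof -
  interpret po_group G by fact
  show ?thesis by unfold_locales (use assms(2) in simp)
qed

lemma o_group_l_group: "o_group G \<Longrightarrow> l_group G"
proof -
  assume "o_group G"
  then interpret o_group G .
  show ?thesis
  proof (rule l_groupI)
    show "po_group G" by unfold_locales
    fix x y assume "x \<in> carrier G" "y \<in> carrier G"
    then show "\<exists>s\<in>carrier G. leq G x s \<and> leq G y s \<and> (\<forall>z\<in>carrier G. leq G x z \<and> leq G y z \<longrightarrow> leq G s z)"
      using tot.total_order_total[of x y] leq_refl by auto
  qed
qed

context l_group
begin

lemmas jn_least = lat.join_le[unfolded carrier_poset_of le_poset_of]

lemma jn_eqI:
  assumes "x \<in> carrier G" "y \<in> carrier G" "s \<in> carrier G" "x \<preceq> s" "y \<preceq> s"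
    and "\<And>z. \<lbrakk>z \<in> carrier G; x \<preceq> z; y \<preceq> z\<rbrakk> \<Longrightarrow> s \<preceq> z"
  shows "x \<or>\<^sub>l y = s"
  by (rule leq_antisym) (use assms in \<open>auto intro: jn_least jn_closed jn_left jn_right\<close>)

lemma mt_eqI:
  assumes "x \<in> carrier G" "y \<in> carrier G" "s \<in> carrier G" "s \<preceq> x" "s \<preceq> y"
    and "\<And>z. \<lbrakk>z \<in> carrier G; z \<preceq> x; z \<preceq> y\<rbrakk> \<Longrightarrow> z \<preceq> s"
  shows "x \<and>\<^sub>l y = s"
  by (rule leq_antisym) (use assms in \<open>auto intro: mt_greatest mt_closed mt_left mt_right\<close>)

lemma jn_absorb: "\<lbrakk>x \<in> carrier G; y \<in> carrier G; x \<preceq> y\<rbrakk> \<Longrightarrow> x \<or>\<^sub>l y = y"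
  by (rule jn_eqI) (auto intro: leq_refl)

lemma mt_absorb: "\<lbrakk>x \<in> carrier G; y \<in> carrier G; x \<preceq> y\<rbrakk> \<Longrightarrow> x \<and>\<^sub>l y = x"
  by (rule mt_eqI) (auto intro: leq_refl)

lemma le_iff_jn: "\<lbrakk>x \<in> carrier G; y \<in> carrier G\<rbrakk> \<Longrightarrow> x \<preceq> y \<longleftrightarrow> x \<or>\<^sub>l y = y"
  using jn_absorb jn_left by metis

text \<open>Inversion is an order-reversing bijection, so it exchanges joins and meets. Through this
  identity several facts about meets reduce to facts about joins.\<close>

lemma mt_eq_inv_jn:
  assumes x: "x \<in> carrier G" and y: "y \<in> carrier G"
  shows "x \<and>\<^sub>l y = inv (inv x \<or>\<^sub>l inv y)"
proof (rule mt_eqI)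
  have j: "inv x \<or>\<^sub>l inv y \<in> carrier G" using x y by (simp add: jn_closed)
  show "inv (inv x \<or>\<^sub>l inv y) \<preceq> x" "inv (inv x \<or>\<^sub>l inv y) \<preceq> y"
    using inv_le[OF _ j, of "inv x"] inv_le[OF _ j, of "inv y"] x y by (auto simp: jn_left jn_right)
  fix z assume z: "z \<in> carrier G" "z \<preceq> x" "z \<preceq> y"
  have "inv x \<or>\<^sub>l inv y \<preceq> inv z"
    using x y z by (intro jn_least) (auto intro: inv_le)
  then show "z \<preceq> inv (inv x \<or>\<^sub>l inv y)"
    using inv_le[OF j _ , of "inv z"] z by auto
qed (use x y in \<open>auto simp: jn_closed\<close>)

text \<open>Left translation by \<open>z\<close> is an order automorphism, with left translation by
  \<open>inv z\<close> as its inverse, and so preserves suprema.\<close>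

lemma jn_mult_left:
  assumes x: "x \<in> carrier G" and y: "y \<in> carrier G" and z: "z \<in> carrier G"
  shows "z \<otimes> (x \<or>\<^sub>l y) = (z \<otimes> x) \<or>\<^sub>l (z \<otimes> y)"
proof (rule jn_eqI[symmetric])
  show "z \<otimes> x \<preceq> z \<otimes> (x \<or>\<^sub>l y)" "z \<otimes> y \<preceq> z \<otimes> (x \<or>\<^sub>l y)"
    using x y z by (auto intro!: translate_left simp: jn_closed jn_left jn_right)
  fix w assume w: "w \<in> carrier G" "z \<otimes> x \<preceq> w" "z \<otimes> y \<preceq> w"
  have "inv z \<otimes> (z \<otimes> x) \<preceq> inv z \<otimes> w" "inv z \<otimes> (z \<otimes> y) \<preceq> inv z \<otimes> w"
    using x y z w by (auto intro!: translate_left)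
  then have "x \<or>\<^sub>l y \<preceq> inv z \<otimes> w"
    using x y z w by (intro jn_least) (auto simp: m_assoc[symmetric])
  then have "z \<otimes> (x \<or>\<^sub>l y) \<preceq> z \<otimes> (inv z \<otimes> w)"
    using x y z w by (intro translate_left) (auto simp: jn_closed)
  then show "z \<otimes> (x \<or>\<^sub>l y) \<preceq> w"
    using z w by (simp add: m_assoc[symmetric])
qed (use x y z in \<open>auto simp: jn_closed\<close>)

lemma jn_mult_right:
  assumes x: "x \<in> carrier G" and y: "y \<in> carrier G" and z: "z \<in> carrier G"
  shows "(x \<or>\<^sub>l y) \<otimes> z = (x \<otimes> z) \<or>\<^sub>l (y \<otimes> z)"
proof (rule jn_eqI[symmetric])
  show "x \<otimes> z \<preceq> (x \<or>\<^sub>l y) \<otimes> z" "y \<otimes> z \<preceq> (x \<or>\<^sub>l y) \<otimes> z"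
    using x y z by (auto intro!: translate_right simp: jn_closed jn_left jn_right)
  fix w assume w: "w \<in> carrier G" "x \<otimes> z \<preceq> w" "y \<otimes> z \<preceq> w"
  have "(x \<otimes> z) \<otimes> inv z \<preceq> w \<otimes> inv z" "(y \<otimes> z) \<otimes> inv z \<preceq> w \<otimes> inv z"
    using x y z w by (auto intro!: translate_right)
  then have "x \<or>\<^sub>l y \<preceq> w \<otimes> inv z"
    using x y z w by (intro jn_least) (auto simp: m_assoc)
  then have "(x \<or>\<^sub>l y) \<otimes> z \<preceq> (w \<otimes> inv z) \<otimes> z"
    using x y z w by (intro translate_right) (auto simp: jn_closed)
  then show "(x \<or>\<^sub>l y) \<otimes> z \<preceq> w"
    using z w by (simp add: m_assoc)
qed (use x y z in \<open>auto simp: jn_closed\<close>)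

lemma mt_mult_left:
  assumes x: "x \<in> carrier G" and y: "y \<in> carrier G" and z: "z \<in> carrier G"
  shows "z \<otimes> (x \<and>\<^sub>l y) = (z \<otimes> x) \<and>\<^sub>l (z \<otimes> y)"
  using x y z by (simp add: mt_eq_inv_jn inv_mult_group jn_mult_right[symmetric] jn_closed)

lemma mt_mult_right:
  assumes x: "x \<in> carrier G" and y: "y \<in> carrier G" and z: "z \<in> carrier G"
  shows "(x \<and>\<^sub>l y) \<otimes> z = (x \<otimes> z) \<and>\<^sub>l (y \<otimes> z)"
  using x y z by (simp add: mt_eq_inv_jn inv_mult_group jn_mult_left[symmetric] jn_closed)

lemma inv_jn: "\<lbrakk>x \<in> carrier G; y \<in> carrier G\<rbrakk> \<Longrightarrow> inv (x \<or>\<^sub>l y) = inv x \<and>\<^sub>l inv y"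
  by (simp add: mt_eq_inv_jn)

lemma inv_mt: "\<lbrakk>x \<in> carrier G; y \<in> carrier G\<rbrakk> \<Longrightarrow> inv (x \<and>\<^sub>l y) = inv x \<or>\<^sub>l inv y"
  by (simp add: mt_eq_inv_jn jn_closed)

end

section \<open>Homomorphisms of ordered groups\<close>

lemma l_homI:
  assumes "l_group G" "l_group H" "h \<in> hom G H"
    and jn: "\<And>x y. \<lbrakk>x \<in> carrier G; y \<in> carrier G\<rbrakk> \<Longrightarrow>
      h (x \<squnion>\<^bsub>poset_of G\<^esub> y) = h x \<squnion>\<^bsub>poset_of H\<^esub> h y"
  shows "h \<in> l_hom G H"
proof -
  interpret G: l_group G by fact
  interpret H: l_group H by fact
  interpret group_hom G H h using assms(3) by unfold_locales
  \<comment> \<open>A group homomorphism that preserves joins preserves meets, since these are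
    inverses of joins of inverses.\<close>
  have "h (x \<sqinter>\<^bsub>poset_of G\<^esub> y) = h x \<sqinter>\<^bsub>poset_of H\<^esub> h y" if "x \<in> carrier G" "y \<in> carrier G" for x y
    using that by (simp add: G.mt_eq_inv_jn H.mt_eq_inv_jn G.jn_closed H.jn_closed jn)
  then show ?thesis
    using assms(3) jn G.lat.lattice_axioms H.lat.lattice_axioms
    by (simp add: l_hom_def join_pres_def meet_pres_def)
qed

lemma l_hom_hom: "h \<in> l_hom G H \<Longrightarrow> h \<in> hom G H"
  by (simp add: l_hom_def)

lemma l_hom_closed: "\<lbrakk>h \<in> l_hom G H; x \<in> carrier G\<rbrakk> \<Longrightarrow> h x \<in> carrier H"
  by (auto simp: l_hom_def hom_def)

lemma l_hom_mult:
  "\<lbrakk>h \<in> l_hom G H; x \<in> carrier G; y \<in> carrier G\<rbrakk> \<Longrightarrow> h (x \<otimes>\<^bsub>G\<^esub> y) = h x \<otimes>\<^bsub>H\<^esub> h y"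
  by (simp add: l_hom_def hom_def)

lemma l_hom_jn:
  "\<lbrakk>h \<in> l_hom G H; x \<in> carrier G; y \<in> carrier G\<rbrakk> \<Longrightarrow>
     h (x \<squnion>\<^bsub>poset_of G\<^esub> y) = h x \<squnion>\<^bsub>poset_of H\<^esub> h y"
  by (simp add: l_hom_def join_pres_def)

lemma positive_homI:
  assumes "po_group G" "po_group H" "p \<in> hom G H"
    and "\<And>x y. \<lbrakk>x \<in> carrier G; y \<in> carrier G; x \<preceq>\<^bsub>G\<^esub> y\<rbrakk> \<Longrightarrow> p x \<preceq>\<^bsub>H\<^esub> p y"
  shows "p \<in> positive_hom G H"
proof -
  interpret G: po_group G by fact
  interpret H: po_group H by fact
  show ?thesis
    unfolding positive_hom_def isotone_def
    using assms(3,4) G.po.weak_partial_order_axioms H.po.weak_partial_order_axioms by simp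
qed

lemma positive_hom_leq:
  "\<lbrakk>p \<in> positive_hom G H; x \<in> carrier G; y \<in> carrier G; x \<preceq>\<^bsub>G\<^esub> y\<rbrakk> \<Longrightarrow> p x \<preceq>\<^bsub>H\<^esub> p y"
  by (simp add: positive_hom_def isotone_def)

lemma l_hom_leq:
  assumes "l_group G" "l_group H" "h \<in> l_hom G H" "x \<in> carrier G" "y \<in> carrier G" "x \<preceq>\<^bsub>G\<^esub> y"
  shows "h x \<preceq>\<^bsub>H\<^esub> h y"
  using assms l_group.le_iff_jn[of G] l_group.le_iff_jn[of H] by (simp add: l_hom_closed flip: l_hom_jn)

lemma l_hom_compose:
  assumes "l_group G" "l_group H" "l_group K" "f \<in> l_hom G H" "g \<in> l_hom H K"
  shows "(\<lambda>x. g (f x)) \<in> l_hom G K"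
proof (rule l_homI)
  show "(\<lambda>x. g (f x)) \<in> hom G K"
    by (rule homI) (simp_all add: l_hom_closed[OF assms(5)] l_hom_closed[OF assms(4)]
      l_hom_mult[OF assms(5)] l_hom_mult[OF assms(4)])
  fix x y assume "x \<in> carrier G" "y \<in> carrier G"
  then show "g (f (x \<squnion>\<^bsub>poset_of G\<^esub> y)) = g (f x) \<squnion>\<^bsub>poset_of K\<^esub> g (f y)"
    by (simp add: l_hom_closed[OF assms(4)] l_hom_jn[OF assms(4)] l_hom_jn[OF assms(5)])
qed fact+

text \<open>Only the values on the carrier matter. This permits passing to \<open>restrict\<close>
  versions, for which uniqueness in \<open>free_l_group_over\<close> is stated.\<close>

lemma l_hom_cong:
  assumes "l_group G" "h \<in> l_hom G H" "\<And>x. x \<in> carrier G \<Longrightarrow> h x = k x"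
  shows "k \<in> l_hom G H"
proof -
  interpret l_group G by fact
  show ?thesis
    using assms(2,3)
    by (auto simp: l_hom_def hom_def join_pres_def meet_pres_def jn_closed mt_closed Pi_iff)
qed

section \<open>Prime subgroups as preorders\<close>

text \<open>The preorders \<open>P x \<le> P y\<close> obtained from prime subgroups \<open>P\<close>, together with the trivial one.\<close>

locale prime_preorder = l_group G for G :: "('a, 'm) pogroup_scheme" (structure) +
  fixes R :: "'a \<Rightarrow> 'a \<Rightarrow> bool"
  assumes R_total: "\<lbrakk>x \<in> carrier G; y \<in> carrier G\<rbrakk> \<Longrightarrow> R x y \<or> R y x"
    and R_trans: "\<lbrakk>x \<in> carrier G; y \<in> carrier G; z \<in> carrier G; R x y; R y z\<rbrakk> \<Longrightarrow> R x z"
    and R_mult: "\<lbrakk>x \<in> carrier G; y \<in> carrier G; z \<in> carrier G; R x y\<rbrakk> \<Longrightarrow> R (x \<otimes> z) (y \<otimes> z)"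
    and R_leq: "\<lbrakk>x \<in> carrier G; y \<in> carrier G; x \<preceq> y\<rbrakk> \<Longrightarrow> R x y"
    and R_jn: "\<lbrakk>x \<in> carrier G; y \<in> carrier G; z \<in> carrier G; R x z; R y z\<rbrakk> \<Longrightarrow> R (x \<or>\<^sub>l y) z"

definition preorder_ker :: "('a, 'm) pogroup_scheme \<Rightarrow> ('a \<Rightarrow> 'a \<Rightarrow> bool) \<Rightarrow> 'a set" where
  "preorder_ker G R = {x \<in> carrier G. R x \<one>\<^bsub>G\<^esub> \<and> R \<one>\<^bsub>G\<^esub> x}"

text \<open>The coset order read on representatives, so that the preorders of different primes live
  on the same set and can be compared.\<close>

definition coset_le :: "('a, 'm) pogroup_scheme \<Rightarrow> 'a set \<Rightarrow> 'a \<Rightarrow> 'a \<Rightarrow> bool" where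
  "coset_le G P x y \<longleftrightarrow> (\<exists>t\<in>P. x \<preceq>\<^bsub>G\<^esub> t \<otimes>\<^bsub>G\<^esub> y)"

text \<open>Right invariance is part of \<open>prime_preorder\<close>; this is the additional
  condition under which the kernel is normal.\<close>

definition left_invariant :: "('a, 'm) pogroup_scheme \<Rightarrow> ('a \<Rightarrow> 'a \<Rightarrow> bool) \<Rightarrow> bool" where
  "left_invariant G R \<longleftrightarrow>
     (\<forall>x\<in>carrier G. \<forall>y\<in>carrier G. \<forall>z\<in>carrier G. R x y \<longrightarrow> R (z \<otimes>\<^bsub>G\<^esub> x) (z \<otimes>\<^bsub>G\<^esub> y))"

section \<open>From prime preorders to prime subgroups\<close>

context prime_preorder
begin

abbreviation equivalent (infix "\<sim>" 50) where "x \<sim> y \<equiv> R x y \<and> R y x"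

lemma R_refl: "x \<in> carrier G \<Longrightarrow> R x x"
  using R_total by blast

lemma equivalent_jn: "\<lbrakk>x \<in> carrier G; y \<in> carrier G; R x y\<rbrakk> \<Longrightarrow> x \<or>\<^sub>l y \<sim> y"
  by (simp add: R_jn R_refl R_leq jn_closed jn_right)

lemma equivalent_mult: "\<lbrakk>x \<in> carrier G; y \<in> carrier G; z \<in> carrier G; x \<sim> y\<rbrakk> \<Longrightarrow> x \<otimes> z \<sim> y \<otimes> z"
  by (simp add: R_mult)

text \<open>The meet is reached from the join by \<open>x \<and>\<^sub>l y = y \<otimes> inv (x
  \<or>\<^sub>l y) \<otimes> x\<close>, where \<open>y\<close> is equivalent to the join. In this
  form only right translations are applied to equivalences, as \<open>R\<close> need not be left
  invariant.\<close>

lemma equivalent_mt: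
  assumes x: "x \<in> carrier G" and y: "y \<in> carrier G" and R: "R x y"
  shows "x \<and>\<^sub>l y \<sim> x"
proof -
  let ?j = "x \<or>\<^sub>l y"
  have j: "?j \<in> carrier G" using x y by (simp add: jn_closed)
  have "y \<and>\<^sub>l x = y \<otimes> (inv x \<and>\<^sub>l inv y) \<otimes> x"
    using x y by (simp add: mt_mult_left mt_mult_right m_assoc)
  then have eq: "x \<and>\<^sub>l y = (y \<otimes> inv ?j) \<otimes> x"
    using x y by (simp add: inv_jn meet_comm)
  have "y \<otimes> inv ?j \<sim> ?j \<otimes> inv ?j"
    using equivalent_jn[OF x y R] x y j by (intro equivalent_mult) auto
  then have "y \<otimes> inv ?j \<sim> \<one>" using j by simp
  then have "y \<otimes> inv ?j \<otimes> x \<sim> \<one> \<otimes> x" using x y j by (intro equivalent_mult) auto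
  then show ?thesis using eq x by simp
qed

text \<open>Right translations by \<open>y\<close> and \<open>inv y\<close> turn one relation into
  the other. So the equivalence classes are the right cosets of the kernel.\<close>

lemma equivalent_iff_ker:
  assumes "x \<in> carrier G" "y \<in> carrier G"
  shows "x \<otimes> inv y \<in> preorder_ker G R \<longleftrightarrow> x \<sim> y"
proof
  assume "x \<otimes> inv y \<in> preorder_ker G R"
  then have "x \<otimes> inv y \<otimes> y \<sim> \<one> \<otimes> y"
    using assms by (intro equivalent_mult) (auto simp: preorder_ker_def)
  then show "x \<sim> y" using assms by (simp add: m_assoc)
next
  assume "x \<sim> y"
  then have "x \<otimes> inv y \<sim> y \<otimes> inv y" using assms by (intro equivalent_mult) auto
  then show "x \<otimes> inv y \<in> preorder_ker G R" using assms by (simp add: preorder_ker_def)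
qed

lemma subgroup_ker: "subgroup (preorder_ker G R) G"
proof (rule subgroupI)
  have *: "inv a \<in> preorder_ker G R" if "a \<in> preorder_ker G R" for a
    using equivalent_iff_ker[of \<one> a] that by (auto simp: preorder_ker_def)
  then show "\<And>a. a \<in> preorder_ker G R \<Longrightarrow> inv a \<in> preorder_ker G R" .
  fix a b assume ab: "a \<in> preorder_ker G R" "b \<in> preorder_ker G R"
  have "a \<sim> inv b"
    using ab(1) *[OF ab(2)] R_trans[of a \<one> "inv b"] R_trans[of "inv b" \<one> a]
    by (auto simp: preorder_ker_def)
  then show "a \<otimes> b \<in> preorder_ker G R"
    using equivalent_iff_ker[of a "inv b"] ab by (auto simp: preorder_ker_def)
qed (use R_refl in \<open>auto simp: preorder_ker_def\<close>)

text \<open>Any two elements of the kernel are equivalent, and then their join and meet are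
  equivalent to them; convexity holds because \<open>R\<close> contains the order.\<close>

lemma convex_l_subgroup_ker: "convex_l_subgroup (preorder_ker G R) G"
  unfolding convex_l_subgroup_def
proof (intro conjI ballI impI)
  note [simp] = preorder_ker_def
  show "subgroup (preorder_ker G R) G" by (rule subgroup_ker)
  fix x y assume x: "x \<in> preorder_ker G R" and y: "y \<in> preorder_ker G R"
  then have G: "x \<in> carrier G" "y \<in> carrier G" by auto
  have xy: "R x y" using R_trans[of x \<one> y] x y by auto
  show "x \<or>\<^sub>l y \<in> preorder_ker G R"
    using y equivalent_jn[OF G xy] R_trans[of "x \<or>\<^sub>l y" y \<one>] R_trans[of \<one> y "x \<or>\<^sub>l y"] jn_closed[OF G] by auto
  show "x \<and>\<^sub>l y \<in> preorder_ker G R"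
    using x G equivalent_mt[OF G xy] R_trans[of "x \<and>\<^sub>l y" x \<one>] R_trans[of \<one> x "x \<and>\<^sub>l y"] mt_closed[OF G] by auto
  fix z assume "z \<in> carrier G" "x \<preceq> z \<and> z \<preceq> y"
  then show "z \<in> preorder_ker G R"
    using x y R_leq[of x z] R_leq[of z y] R_trans[of \<one> x z] R_trans[of z y \<one>] by auto
qed

text \<open>A preorder can be recovered from its kernel. The witness for \<open>R x y\<close> is
  \<open>x \<otimes> inv (x \<and>\<^sub>l y)\<close>, which lies in the kernel because the meet is
  equivalent to \<open>x\<close>.\<close>

lemma coset_le_ker:
  assumes x: "x \<in> carrier G" and y: "y \<in> carrier G"
  shows "coset_le G (preorder_ker G R) x y \<longleftrightarrow> R x y"
proof
  assume "coset_le G (preorder_ker G R) x y"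
  then obtain t where t: "t \<in> carrier G" "t \<sim> \<one>" "x \<preceq> t \<otimes> y"
    by (auto simp: coset_le_def preorder_ker_def)
  have "t \<otimes> y \<sim> \<one> \<otimes> y" using t y by (intro equivalent_mult) auto
  then show "R x y" using R_leq[OF x _ t(3)] R_trans[of x "t \<otimes> y" y] x y t by simp
next
  assume R: "R x y"
  let ?m = "x \<and>\<^sub>l y" and ?t = "x \<otimes> inv (x \<and>\<^sub>l y)"
  have m: "?m \<in> carrier G" using x y by (simp add: mt_closed)
  have "?t \<in> preorder_ker G R" using equivalent_mt[OF x y R] equivalent_iff_ker[OF x m] by simp
  moreover have "?t \<otimes> ?m \<preceq> ?t \<otimes> y" using x y m by (intro translate_left) (auto simp: mt_right)
  then have "x \<preceq> ?t \<otimes> y" using x m by (simp add: m_assoc)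
  ultimately show "coset_le G (preorder_ker G R) x y" by (auto simp: coset_le_def)
qed

lemma le_coset_poset_ker:
  assumes x: "x \<in> carrier G" and y: "y \<in> carrier G"
  shows "le (coset_poset G (preorder_ker G R)) (preorder_ker G R #> x) (preorder_ker G R #> y) \<longleftrightarrow> R x y"
  using coset_le_repr[OF subgroup_ker x y] coset_le_ker[OF x y] x y
  unfolding coset_le_def by (auto simp: coset_poset_def)

lemma coset_eq_iff:
  assumes x: "x \<in> carrier G" and y: "y \<in> carrier G"
  shows "preorder_ker G R #> x = preorder_ker G R #> y \<longleftrightarrow> x \<sim> y"
proof
  assume "preorder_ker G R #> x = preorder_ker G R #> y"
  then show "x \<sim> y" using le_coset_poset_ker[OF x y] le_coset_poset_ker[OF y x]
      le_coset_poset_ker[OF x x] R_refl[OF x] by simp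
next
  assume "x \<sim> y"
  then have "x \<otimes> inv y \<otimes> y \<in> preorder_ker G R #> y"
    using equivalent_iff_ker[OF x y] unfolding r_coset_def by blast
  then show "preorder_ker G R #> x = preorder_ker G R #> y"
    using x y repr_independence[OF _ y subgroup_ker, of x] by (simp add: m_assoc)
qed

lemma total_order_coset_poset: "Order.total_order (coset_poset G (preorder_ker G R))"
proof -
  let ?P = "preorder_ker G R"
  let ?C = "coset_poset G ?P"
  have ex: "\<exists>x\<in>carrier G. A = ?P #> x" if "A \<in> carrier ?C" for A
    using that by (auto simp: coset_poset_def RCOSETS_def)
  have eq: "eq ?C = (=)" by (simp add: coset_poset_def)
  have refl: "le ?C A A" if "A \<in> carrier ?C" for A
    using ex[OF that] le_coset_poset_ker R_refl by auto
  have anti: "A = B" if mem: "A \<in> carrier ?C" "B \<in> carrier ?C" "le ?C A B" "le ?C B A" for A B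
  proof -
    obtain x y where "x \<in> carrier G" "A = ?P #> x" "y \<in> carrier G" "B = ?P #> y"
      using ex[OF mem(1)] ex[OF mem(2)] by blast
    then show ?thesis using that(3,4) le_coset_poset_ker coset_eq_iff by simp
  qed
  have trans: "le ?C A D" if mem: "A \<in> carrier ?C" "B \<in> carrier ?C" "D \<in> carrier ?C" "le ?C A B" "le ?C B D"
    for A B D
  proof -
    obtain x y z where "x \<in> carrier G" "A = ?P #> x" "y \<in> carrier G" "B = ?P #> y" "z \<in> carrier G" "D = ?P #> z"
      using ex[OF mem(1)] ex[OF mem(2)] ex[OF mem(3)] by blast
    then show ?thesis using that(4,5) le_coset_poset_ker R_trans[of x y z] by simp
  qed
  have total: "le ?C A B \<or> le ?C B A" if "A \<in> carrier ?C" "B \<in> carrier ?C" for A B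
    using ex[OF that(1)] ex[OF that(2)] le_coset_poset_ker R_total by metis
  show ?thesis
  proof unfold_locales
    fix A B D assume "A \<in> carrier ?C" "B \<in> carrier ?C" "D \<in> carrier ?C" "le ?C A B" "le ?C B D"
    then show "le ?C A D" by (rule trans)
  next
    fix A B assume "le ?C A B" "le ?C B A" "A \<in> carrier ?C" "B \<in> carrier ?C"
    then show "eq ?C A B" using anti eq by simp
  next
    fix A B assume "A \<in> carrier ?C" "B \<in> carrier ?C"
    then show "le ?C A B \<or> le ?C B A" by (rule total)
  qed (use refl in \<open>auto simp: eq coset_poset_def\<close>)
qed

lemma prime_subgroup_ker: "preorder_ker G R \<noteq> carrier G \<Longrightarrow> prime_subgroup (preorder_ker G R) G"
  by (simp add: prime_subgroup_def convex_l_subgroup_ker total_order_coset_poset)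

end

section \<open>From prime subgroups to prime preorders\<close>

context l_group
begin

text \<open>Witnesses in \<open>P\<close> combine to new ones, by multiplication for transitivity
  and by joins for the lattice condition. Totality is that of the coset order.\<close>

lemma prime_preorder_coset_le:
  assumes P: "prime_subgroup P G"
  shows "prime_preorder G (coset_le G P)"
proof
  have conv: "convex_l_subgroup P G" and tot: "Order.total_order (coset_poset G P)"
    using P unfolding prime_subgroup_def by blast+
  have sub: "subgroup P G" by (rule convex_subgroup[OF conv])
  note PG = subgroup.mem_carrier[OF sub]
  have mono: "s \<otimes> y \<preceq> (s \<or>\<^sub>l t) \<otimes> y" "t \<otimes> y \<preceq> (s \<or>\<^sub>l t) \<otimes> y"
    if "s \<in> P" "t \<in> P" "y \<in> carrier G" for s t y
    using that PG by (auto intro!: translate_right simp: jn_closed jn_left jn_right)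
  fix x y assume x: "x \<in> carrier G" and y: "y \<in> carrier G"
  then have "P #> x \<in> carrier (coset_poset G P)" "P #> y \<in> carrier (coset_poset G P)"
    by (auto simp: coset_poset_def RCOSETS_def)
  then show "coset_le G P x y \<or> coset_le G P y x"
    using Order.total_order.total_order_total[OF tot] coset_le_repr[OF sub x y] coset_le_repr[OF sub y x]
    unfolding coset_le_def by blast
  show "coset_le G P x y" if "x \<preceq> y"
    using that subgroup.one_closed[OF sub] y unfolding coset_le_def by (intro bexI[of _ \<one>]) auto
  fix z assume z: "z \<in> carrier G"
  show "coset_le G P (x \<otimes> z) (y \<otimes> z)" if xy: "coset_le G P x y"
  proof -
    obtain t where t: "t \<in> P" "x \<preceq> t \<otimes> y" using xy by (auto simp: coset_le_def)
    have "x \<otimes> z \<preceq> t \<otimes> y \<otimes> z" using x y z t PG by (intro translate_right) auto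
    then have "x \<otimes> z \<preceq> t \<otimes> (y \<otimes> z)" using y z t PG by (simp add: m_assoc)
    then show ?thesis using t by (auto simp: coset_le_def)
  qed
  show "coset_le G P x z" if xy: "coset_le G P x y" and yz: "coset_le G P y z"
  proof -
    obtain s t where s: "s \<in> P" "x \<preceq> s \<otimes> y" and t: "t \<in> P" "y \<preceq> t \<otimes> z"
      using xy yz by (auto simp: coset_le_def)
    have "s \<otimes> y \<preceq> s \<otimes> (t \<otimes> z)" using y z s t PG by (intro translate_left) auto
    then have "x \<preceq> s \<otimes> (t \<otimes> z)" using leq_trans[OF s(2)] x y z s t PG by auto
    then have "x \<preceq> (s \<otimes> t) \<otimes> z" using z s t PG by (simp add: m_assoc)
    then show ?thesis using subgroup.m_closed[OF sub s(1) t(1)] by (auto simp: coset_le_def)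
  qed
  show "coset_le G P (x \<or>\<^sub>l y) z" if xz: "coset_le G P x z" and yz: "coset_le G P y z"
  proof -
    obtain s t where s: "s \<in> P" "x \<preceq> s \<otimes> z" and t: "t \<in> P" "y \<preceq> t \<otimes> z"
      using xz yz by (auto simp: coset_le_def)
    have j: "s \<or>\<^sub>l t \<in> P" by (rule convex_jn[OF conv s(1) t(1)])
    have "x \<preceq> (s \<or>\<^sub>l t) \<otimes> z" "y \<preceq> (s \<or>\<^sub>l t) \<otimes> z"
      using leq_trans[OF s(2) mono(1)[OF s(1) t(1) z]] leq_trans[OF t(2) mono(2)[OF s(1) t(1) z]]
        x y z PG s t PG[OF j] by auto
    then have "x \<or>\<^sub>l y \<preceq> (s \<or>\<^sub>l t) \<otimes> z" using x y z PG[OF j] by (intro jn_least) auto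
    then show ?thesis using j by (auto simp: coset_le_def)
  qed
qed

text \<open>An element related both ways to the identity lies between \<open>inv t\<close> and
  \<open>s\<close> for some \<open>s\<close> and \<open>t\<close> in \<open>P\<close>, so convexity
  applies. With \<open>coset_le_ker\<close> this makes \<open>coset_le\<close> and
  \<open>preorder_ker\<close> inverse to each other on the carrier.\<close>

lemma preorder_ker_coset_le:
  assumes P: "convex_l_subgroup P G"
  shows "preorder_ker G (coset_le G P) = P"
proof -
  have sub: "subgroup P G" by (rule convex_subgroup[OF P])
  note PG = subgroup.mem_carrier[OF sub] and inv = subgroup.m_inv_closed[OF sub]
  have "x \<in> P" if x: "x \<in> carrier G" and st: "s \<in> P" "x \<preceq> s" "t \<in> P" "\<one> \<preceq> t \<otimes> x" for x s t
  proof -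
    have t: "t \<in> carrier G" by (rule PG[OF st(3)])
    have "inv t \<otimes> \<one> \<preceq> inv t \<otimes> (t \<otimes> x)" using x t by (intro translate_left st(4)) auto
    then have "inv t \<preceq> x" using x t by (simp add: m_assoc[symmetric])
    then show ?thesis using convexD[OF P inv[OF st(3)] st(1) x] st(2) by simp
  qed
  moreover have "coset_le G P x \<one>" "coset_le G P \<one> x" if "x \<in> P" for x
    using that inv[OF that] PG[OF that] leq_refl unfolding coset_le_def
    by (intro bexI[of _ x] bexI[of _ "inv x"]; simp)+
  ultimately show ?thesis
    unfolding preorder_ker_def using PG by (auto simp: coset_le_def)
qed

end

section \<open>Preorders from maximal filters of positive elements\<close>

context l_group
begin

text \<open>Upward closure is left out, so that a single positive element other than the identity
  already forms such a set and can be extended to a maximal one.\<close>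

definition pos_filter :: "'a set \<Rightarrow> bool" where
  "pos_filter U \<longleftrightarrow> U \<subseteq> {x \<in> carrier G. \<one> \<preceq> x} \<and> \<one> \<notin> U \<and> (\<forall>x\<in>U. \<forall>y\<in>U. x \<and>\<^sub>l y \<in> U)"

text \<open>Comparison modulo the elements orthogonal to some member of \<open>U\<close>: for a
  maximal \<open>U\<close> the kernel is the classical description of a minimal prime as a union of
  polars.\<close>

definition filter_le :: "'a set \<Rightarrow> 'a \<Rightarrow> 'a \<Rightarrow> bool" where
  "filter_le U x y \<longleftrightarrow> (\<exists>u\<in>U. ((x \<otimes> inv y) \<or>\<^sub>l \<one>) \<and>\<^sub>l u = \<one>)"

text \<open>Zorn's lemma; two members of the union of a chain lie in a common set of the chain,
  whose closure under meets then applies.\<close>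

lemma pos_filter_extend:
  assumes "pos_filter A"
  shows "\<exists>U. A \<subseteq> U \<and> pos_filter U \<and> (\<forall>X. pos_filter X \<and> U \<subseteq> X \<longrightarrow> X = U)"
proof -
  let ?\<A> = "{U. pos_filter U \<and> A \<subseteq> U}"
  have "\<Union>\<C> \<in> ?\<A>" if ne: "\<C> \<noteq> {}" and ch: "subset.chain ?\<A> \<C>" for \<C>
  proof -
    have mem: "X \<in> \<C> \<Longrightarrow> pos_filter X \<and> A \<subseteq> X" for X
      using ch by (auto simp: subset_chain_def)
    have "x \<and>\<^sub>l y \<in> \<Union>\<C>" if "x \<in> X" "X \<in> \<C>" "y \<in> Y" "Y \<in> \<C>" for x y X Y
    proof -
      have "X \<subseteq> Y \<or> Y \<subseteq> X" using ch that by (auto simp: subset_chain_def)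
      then show ?thesis using that mem unfolding pos_filter_def by blast
    qed
    then have "pos_filter (\<Union>\<C>)" using mem unfolding pos_filter_def by blast
    then show ?thesis using mem ne by blast
  qed
  then have "\<exists>M\<in>?\<A>. \<forall>X\<in>?\<A>. M \<subseteq> X \<longrightarrow> X = M"
    using assms by (intro subset_Zorn_nonempty) auto
  then obtain M where M: "pos_filter M" "A \<subseteq> M"
    and max: "\<And>X. pos_filter X \<Longrightarrow> A \<subseteq> X \<Longrightarrow> M \<subseteq> X \<Longrightarrow> X = M"
    by auto
  show ?thesis
  proof (intro exI conjI allI impI)
    fix X assume "pos_filter X \<and> M \<subseteq> X"
    with M max[of X] show "X = M" by auto
  qed (fact M)+
qed

text \<open>Maximality is played against \<open>?X\<close>, the upward closed filter generated by
  \<open>U\<close> and \<open>z\<close>: if it omits the identity then it equals \<open>U\<close>,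
  so that \<open>z\<close> lies in \<open>U\<close>.\<close>

lemma pos_filter_dichotomy:
  assumes U: "pos_filter U" "U \<noteq> {}" and max: "\<And>X. \<lbrakk>pos_filter X; U \<subseteq> X\<rbrakk> \<Longrightarrow> X = U"
    and z: "z \<in> carrier G" "\<one> \<preceq> z"
  shows "z \<in> U \<or> (\<exists>u\<in>U. z \<and>\<^sub>l u = \<one>)"
proof (rule ccontr)
  assume contra: "\<not> ?thesis"
  let ?X = "{x \<in> carrier G. \<one> \<preceq> x \<and> (\<exists>u\<in>U. z \<and>\<^sub>l u \<preceq> x)}"
  have UG: "u \<in> carrier G" "\<one> \<preceq> u" if "u \<in> U" for u using U(1) that by (auto simp: pos_filter_def)
  have "\<one> \<notin> ?X"
  proof
    assume "\<one> \<in> ?X"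
    then obtain u where u: "u \<in> U" "z \<and>\<^sub>l u \<preceq> \<one>" by blast
    then have "z \<and>\<^sub>l u = \<one>"
      using z UG[OF u(1)] by (intro leq_antisym) (auto intro: mt_greatest mt_closed)
    then show False using contra u by blast
  qed
  moreover have "x \<and>\<^sub>l y \<in> ?X" if "x \<in> ?X" "y \<in> ?X" for x y
  proof -
    obtain u v where u: "u \<in> U" "z \<and>\<^sub>l u \<preceq> x" and v: "v \<in> U" "z \<and>\<^sub>l v \<preceq> y" using \<open>x \<in> ?X\<close> \<open>y \<in> ?X\<close> by blast
    have uv: "u \<and>\<^sub>l v \<in> U" using u v U(1) by (auto simp: pos_filter_def)
    have "u \<and>\<^sub>l v \<preceq> u" "u \<and>\<^sub>l v \<preceq> v" using u v UG by (auto simp: mt_left mt_right)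
    then have "z \<and>\<^sub>l (u \<and>\<^sub>l v) \<preceq> z \<and>\<^sub>l u" "z \<and>\<^sub>l (u \<and>\<^sub>l v) \<preceq> z \<and>\<^sub>l v"
      using z(1) UG[OF u(1)] UG[OF v(1)] UG[OF uv]
      by (auto intro!: mt_greatest mt_left mt_closed leq_trans[OF mt_right[of z "u \<and>\<^sub>l v"]])
    then have "z \<and>\<^sub>l (u \<and>\<^sub>l v) \<preceq> x \<and>\<^sub>l y"
      using that u(2) v(2) z(1) UG[OF u(1)] UG[OF v(1)] UG[OF uv]
      by (intro mt_greatest) (auto intro: leq_trans[of _ "z \<and>\<^sub>l u" x] leq_trans[of _ "z \<and>\<^sub>l v" y] mt_closed)
    then show ?thesis using that uv by (auto intro: mt_greatest mt_closed)
  qed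
  ultimately have X: "pos_filter ?X" unfolding pos_filter_def by blast
  have "U \<subseteq> ?X" using UG z(1) mt_right by blast
  then have "?X = U" by (rule max[OF X])
  moreover obtain u where "u \<in> U" using U(2) by blast
  then have "z \<in> ?X" using z UG mt_left by blast
  ultimately show False using contra by blast
qed

text \<open>The meet \<open>?m\<close> lies below \<open>w\<close>, thus below
  \<open>a \<otimes> w\<close>, and so below \<open>(a \<otimes> b) \<and>\<^sub>l (a \<otimes> w) =
  a \<otimes> (b \<and>\<^sub>l w) = a\<close>; and \<open>a\<close> is orthogonal to
  \<open>w\<close>.\<close>

lemma orthogonal_mult:
  assumes a: "a \<in> carrier G" "\<one> \<preceq> a" and b: "b \<in> carrier G" and w: "w \<in> carrier G" "\<one> \<preceq> w"
    and "\<one> \<preceq> b" "a \<and>\<^sub>l w = \<one>" "b \<and>\<^sub>l w = \<one>"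
  shows "(a \<otimes> b) \<and>\<^sub>l w = \<one>"
proof (rule leq_antisym)
  let ?m = "(a \<otimes> b) \<and>\<^sub>l w"
  have ab: "a \<otimes> b \<in> carrier G" and m: "?m \<in> carrier G" using a b w by (auto simp: mt_closed)
  have aw: "w \<preceq> a \<otimes> w" using translate_right[OF _ a(1) w(1) a(2)] w by simp
  have "?m \<preceq> w" using ab w by (simp add: mt_right)
  then have "?m \<preceq> a \<otimes> w" using aw leq_trans[OF _ aw] m w a by auto
  then have "?m \<preceq> (a \<otimes> b) \<and>\<^sub>l (a \<otimes> w)"
    using ab m a w by (intro mt_greatest) (auto simp: mt_left)
  also have "(a \<otimes> b) \<and>\<^sub>l (a \<otimes> w) = a" using assms by (simp flip: mt_mult_left)
  finally have "?m \<preceq> a" .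
  then have "?m \<preceq> a \<and>\<^sub>l w" using m a w ab by (intro mt_greatest) (auto simp: mt_right)
  then show "?m \<preceq> \<one>" using assms by simp
  have "\<one> \<preceq> a \<otimes> b"
    using translate_left[OF one_closed b a(1)] assms leq_trans[OF a(2), of "a \<otimes> b"] by simp
  then show "\<one> \<preceq> ?m" using ab w by (intro mt_greatest) auto
qed (use assms in \<open>auto simp: mt_closed\<close>)

lemma orthogonal_antimono:
  assumes "a \<in> carrier G" "b \<in> carrier G" "w \<in> carrier G" "v \<in> carrier G"
    and "\<one> \<preceq> a" "\<one> \<preceq> v" "a \<preceq> b" "v \<preceq> w" "b \<and>\<^sub>l w = \<one>"
  shows "a \<and>\<^sub>l v = \<one>"
proof (rule leq_antisym)
  have "a \<and>\<^sub>l v \<preceq> b \<and>\<^sub>l w"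
    using assms(1-4) mt_left[of a v] mt_right[of a v] leq_trans[OF _ assms(7)] leq_trans[OF _ assms(8)]
    by (intro mt_greatest) (auto simp: mt_closed)
  then show "a \<and>\<^sub>l v \<preceq> \<one>" using assms by simp
qed (use assms in \<open>auto simp: mt_closed mt_greatest\<close>)

lemma pos_part_mult_leq:
  assumes x: "x \<in> carrier G" and y: "y \<in> carrier G"
  shows "(x \<otimes> y) \<or>\<^sub>l \<one> \<preceq> (x \<or>\<^sub>l \<one>) \<otimes> (y \<or>\<^sub>l \<one>)"
proof -
  let ?x = "x \<or>\<^sub>l \<one>" and ?y = "y \<or>\<^sub>l \<one>"
  have c: "?x \<in> carrier G" "?y \<in> carrier G" using x y by (auto simp: jn_closed)
  have "x \<otimes> y \<preceq> ?x \<otimes> y" "?x \<otimes> y \<preceq> ?x \<otimes> ?y"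
    using x y c by (auto intro!: translate_left translate_right simp: jn_left)
  moreover have "\<one> \<preceq> ?x" "?x \<preceq> ?x \<otimes> ?y"
    using translate_left[of \<one> ?y ?x] x y c by (auto simp: jn_right)
  ultimately show ?thesis
    using x y c leq_trans[of "x \<otimes> y" "?x \<otimes> y" "?x \<otimes> ?y"] leq_trans[of \<one> ?x "?x \<otimes> ?y"]
    by (intro jn_least) auto
qed

text \<open>Maximality enters through totality. The positive parts of \<open>?d\<close> and
  \<open>inv ?d\<close> are orthogonal: if that of \<open>?d\<close> lies in \<open>U\<close>, it is
  a witness for the reverse comparison, and otherwise \<open>pos_filter_dichotomy\<close> supplies a
  witness.\<close>

lemma prime_preorder_filter_le:
  assumes U: "pos_filter U" "U \<noteq> {}" and max: "\<And>X. \<lbrakk>pos_filter X; U \<subseteq> X\<rbrakk> \<Longrightarrow> X = U"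
  shows "prime_preorder G (filter_le U)"
proof
  have UG: "u \<in> carrier G" "\<one> \<preceq> u" if "u \<in> U" for u using U(1) that by (auto simp: pos_filter_def)
  have Umt: "u \<and>\<^sub>l v \<in> U" if "u \<in> U" "v \<in> U" for u v using U(1) that by (auto simp: pos_filter_def)
  \<comment> \<open>Transitivity and the join condition both reduce to this: the new witness is the
    meet of the two given ones.\<close>
  have orth: "\<exists>w\<in>U. c \<and>\<^sub>l w = \<one>"
    if "u \<in> U" "v \<in> U" "a \<and>\<^sub>l u = \<one>" "b \<and>\<^sub>l v = \<one>" "a \<in> carrier G" "b \<in> carrier G" "\<one> \<preceq> a" "\<one> \<preceq> b"
      "c \<in> carrier G" "\<one> \<preceq> c" "c \<preceq> a \<otimes> b" for a b c u v
  proof -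
    let ?w = "u \<and>\<^sub>l v"
    note w = UG[OF Umt[OF that(1,2)]]
    have "a \<and>\<^sub>l ?w = \<one>" "b \<and>\<^sub>l ?w = \<one>"
      using that w UG by (auto intro: orthogonal_antimono[of a a u ?w] orthogonal_antimono[of b b v ?w]
        leq_refl mt_left mt_right)
    then have "(a \<otimes> b) \<and>\<^sub>l ?w = \<one>" using that w by (intro orthogonal_mult)
    then have "c \<and>\<^sub>l ?w = \<one>"
      using that w by (intro orthogonal_antimono[of c "a \<otimes> b" ?w ?w]) (auto intro: leq_refl)
    then show ?thesis using Umt[OF that(1,2)] by blast
  qed
  fix x y assume x: "x \<in> carrier G" and y: "y \<in> carrier G"
  let ?d = "x \<otimes> inv y"
  have d: "?d \<in> carrier G" and inv_d: "inv ?d = y \<otimes> inv x" using x y by (auto simp: inv_mult_group)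
  have "?d \<or>\<^sub>l \<one> \<in> U \<or> (\<exists>u\<in>U. (?d \<or>\<^sub>l \<one>) \<and>\<^sub>l u = \<one>)"
    using d by (intro pos_filter_dichotomy[OF U max]) (auto simp: jn_closed jn_right)
  moreover have "(inv ?d \<or>\<^sub>l \<one>) \<and>\<^sub>l (?d \<or>\<^sub>l \<one>) = \<one>"
  proof -
    \<comment> \<open>\<open>d \<or> 1 = d (d\<^sup>-\<^sup>1 \<or> 1)\<close>, and \<open>1 \<and> d = (d\<^sup>-\<^sup>1 \<or> 1)\<^sup>-\<^sup>1\<close>\<close>
    let ?n = "inv ?d \<or>\<^sub>l \<one>"
    have n: "?n \<in> carrier G" using d by (auto simp: jn_closed)
    have "?d \<or>\<^sub>l \<one> = ?d \<otimes> ?n" using d n by (simp add: jn_mult_left join_comm)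
    then have "?n \<and>\<^sub>l (?d \<or>\<^sub>l \<one>) = (\<one> \<and>\<^sub>l ?d) \<otimes> ?n" using d n by (simp add: mt_mult_right)
    also have "\<one> \<and>\<^sub>l ?d = inv ?n" using d by (simp add: mt_eq_inv_jn join_comm)
    finally show ?thesis using n by simp
  qed
  ultimately show "filter_le U x y \<or> filter_le U y x"
    unfolding filter_le_def inv_d by blast
  show "filter_le U x y" if "x \<preceq> y"
  proof -
    obtain u where u: "u \<in> U" using U(2) by blast
    have "?d \<preceq> \<one>" using translate_right[OF x y _ that, of "inv y"] y by simp
    then have "?d \<or>\<^sub>l \<one> = \<one>" using d by (simp add: jn_absorb)
    then show ?thesis using u UG[OF u] mt_absorb[of \<one> u] by (auto simp: filter_le_def)
  qed
  fix z assume z: "z \<in> carrier G"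
  show "filter_le U (x \<otimes> z) (y \<otimes> z)" if "filter_le U x y"
  proof -
    have "x \<otimes> z \<otimes> inv (y \<otimes> z) = x \<otimes> inv y"
      using x y z by (simp add: inv_mult_group m_assoc) (simp add: m_assoc[symmetric])
    then show ?thesis using that by (simp add: filter_le_def)
  qed
  show "filter_le U x z" if le: "filter_le U x y" "filter_le U y z"
  proof -
    obtain u v where uv: "u \<in> U" "v \<in> U" "(x \<otimes> inv y \<or>\<^sub>l \<one>) \<and>\<^sub>l u = \<one>" "(y \<otimes> inv z \<or>\<^sub>l \<one>) \<and>\<^sub>l v = \<one>"
      using le by (auto simp: filter_le_def)
    have "x \<otimes> inv z = (x \<otimes> inv y) \<otimes> (y \<otimes> inv z)"
      using x y z by (simp add: m_assoc) (simp add: m_assoc[symmetric])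
    then have "x \<otimes> inv z \<or>\<^sub>l \<one> \<preceq> (x \<otimes> inv y \<or>\<^sub>l \<one>) \<otimes> (y \<otimes> inv z \<or>\<^sub>l \<one>)"
      using x y z pos_part_mult_leq[of "x \<otimes> inv y" "y \<otimes> inv z"] by simp
    then show ?thesis
      unfolding filter_le_def using x y z by (intro orth[OF uv]) (auto simp: jn_closed jn_right)
  qed
  show "filter_le U (x \<or>\<^sub>l y) z" if le: "filter_le U x z" "filter_le U y z"
  proof -
    let ?a = "x \<otimes> inv z \<or>\<^sub>l \<one>" and ?b = "y \<otimes> inv z \<or>\<^sub>l \<one>"
    have ab: "?a \<in> carrier G" "?b \<in> carrier G" "\<one> \<preceq> ?a" "\<one> \<preceq> ?b"
      using x y z by (auto simp: jn_closed jn_right)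
    have "?a \<preceq> ?a \<otimes> ?b" "?b \<preceq> ?a \<otimes> ?b"
      using translate_left[of \<one> ?b ?a] translate_right[of \<one> ?a ?b] ab by auto
    moreover have "x \<otimes> inv z \<preceq> ?a" "y \<otimes> inv z \<preceq> ?b" using x y z by (auto simp: jn_left)
    ultimately have "((x \<otimes> inv z) \<or>\<^sub>l (y \<otimes> inv z)) \<or>\<^sub>l \<one> \<preceq> ?a \<otimes> ?b"
      using x y z ab leq_trans[of "x \<otimes> inv z" ?a "?a \<otimes> ?b"] leq_trans[of "y \<otimes> inv z" ?b "?a \<otimes> ?b"]
        leq_trans[of \<one> ?a "?a \<otimes> ?b"]
      by (intro jn_least) (auto simp: jn_closed)
    then have "((x \<or>\<^sub>l y) \<otimes> inv z) \<or>\<^sub>l \<one> \<preceq> ?a \<otimes> ?b" using x y z by (simp add: jn_mult_right)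
    moreover obtain u v where uv: "u \<in> U" "v \<in> U" "?a \<and>\<^sub>l u = \<one>" "?b \<and>\<^sub>l v = \<one>"
      using le by (auto simp: filter_le_def)
    ultimately show ?thesis
      unfolding filter_le_def using x y z ab by (intro orth[OF uv]) (auto simp: jn_closed jn_right)
  qed
qed

text \<open>Multiplying \<open>x\<close> and \<open>y\<close> by \<open>g\<close> on the left
  conjugates \<open>x \<otimes> inv y\<close> by \<open>g\<close>, and conjugation commutes with
  taking positive parts. The assumption on conjugates is later supplied by
  \<open>conj_orthogonal\<close>.\<close>

lemma left_invariant_filter_le:
  assumes U: "pos_filter U"
    and conj: "\<And>a u g. \<lbrakk>a \<in> carrier G; u \<in> carrier G; g \<in> carrier G; \<one> \<preceq> a; \<one> \<preceq> u; a \<and>\<^sub>l u = \<one>\<rbrakk>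
      \<Longrightarrow> (g \<otimes> a \<otimes> inv g) \<and>\<^sub>l u = \<one>"
  shows "left_invariant G (filter_le U)"
  unfolding left_invariant_def
proof (intro ballI impI)
  fix x y g assume x: "x \<in> carrier G" and y: "y \<in> carrier G" and g: "g \<in> carrier G" and "filter_le U x y"
  then obtain u where u: "u \<in> U" "(x \<otimes> inv y \<or>\<^sub>l \<one>) \<and>\<^sub>l u = \<one>" by (auto simp: filter_le_def)
  then have "(g \<otimes> (x \<otimes> inv y \<or>\<^sub>l \<one>) \<otimes> inv g) \<and>\<^sub>l u = \<one>"
    using x y g U by (intro conj) (auto simp: jn_closed jn_right pos_filter_def)
  moreover have "g \<otimes> (x \<otimes> inv y \<or>\<^sub>l \<one>) \<otimes> inv g = (g \<otimes> x) \<otimes> inv (g \<otimes> y) \<or>\<^sub>l \<one>"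
    using x y g by (simp add: jn_mult_left jn_mult_right inv_mult_group m_assoc)
  ultimately show "filter_le U (g \<otimes> x) (g \<otimes> y)" using u by (auto simp: filter_le_def)
qed

text \<open>A witness \<open>u\<close> would make \<open>x \<and>\<^sub>l u\<close> the identity,
  yet this meet belongs to \<open>U\<close>.\<close>

lemma pos_filter_omitted:
  assumes U: "pos_filter U" and x: "x \<in> U"
  shows "x \<notin> preorder_ker G (filter_le U)"
proof
  assume "x \<in> preorder_ker G (filter_le U)"
  then obtain u where u: "u \<in> U" "(x \<or>\<^sub>l \<one>) \<and>\<^sub>l u = \<one>"
    using x U by (auto simp: preorder_ker_def filter_le_def)
  have "x \<or>\<^sub>l \<one> = x" using x U jn_absorb[of \<one> x] by (auto simp: pos_filter_def join_comm)
  then have "x \<and>\<^sub>l u = \<one>" using u by simp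
  moreover have "x \<and>\<^sub>l u \<in> U" using x u(1) U unfolding pos_filter_def by blast
  ultimately show False using U unfolding pos_filter_def by simp
qed

end

section \<open>Quotients, isomorphic copies, and automorphism groups of chains\<close>

text \<open>Applied to the coordinate maps of subdirect representations, to inclusions, and to maps
  into automorphism groups of chains.\<close>

lemma prime_preorder_pullback:
  assumes G: "l_group G" and H: "prime_preorder H R" and h: "h \<in> l_hom G H"
  shows "prime_preorder G (\<lambda>x y. R (h x) (h y))"
proof -
  interpret G: l_group G by fact
  interpret H: prime_preorder H R by fact
  have hH: "l_group H" by unfold_locales
  note [simp] = l_hom_closed[OF h] l_hom_mult[OF h] l_hom_jn[OF h]
  show ?thesis
  proof
    fix x y assume xy: "x \<in> carrier G" "y \<in> carrier G"
    then show "R (h x) (h y) \<or> R (h y) (h x)" by (simp add: H.R_total)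
    show "R (h x) (h y)" if "x \<preceq>\<^bsub>G\<^esub> y"
      using l_hom_leq[OF G hH h xy that] xy by (simp add: H.R_leq)
    fix z assume z: "z \<in> carrier G"
    show "R (h x) (h z)" if "R (h x) (h y)" "R (h y) (h z)"
      using that xy z H.R_trans[of "h x" "h y" "h z"] by simp
    show "R (h (x \<otimes>\<^bsub>G\<^esub> z)) (h (y \<otimes>\<^bsub>G\<^esub> z))" if "R (h x) (h y)"
      using that xy z by (simp add: H.R_mult)
    show "R (h (x \<squnion>\<^bsub>poset_of G\<^esub> y)) (h z)" if "R (h x) (h z)" "R (h y) (h z)"
      using that xy z by (simp add: H.R_jn)
  qed
qed

lemma left_invariant_pullback:
  "\<lbrakk>left_invariant H R; h \<in> l_hom G H; l_group G\<rbrakk> \<Longrightarrow> left_invariant G (\<lambda>x y. R (h x) (h y))"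
  by (simp add: left_invariant_def l_hom_closed l_hom_mult)

lemma l_hom_one:
  assumes "l_group G" "l_group H" "h \<in> l_hom G H"
  shows "h \<one>\<^bsub>G\<^esub> = \<one>\<^bsub>H\<^esub>"
proof -
  interpret G: l_group G by fact
  interpret H: l_group H by fact
  interpret group_hom G H h using l_hom_hom[OF assms(3)] by unfold_locales
  show ?thesis by (rule hom_one)
qed

lemma preorder_ker_pullback:
  assumes "l_group G" "l_group H" "h \<in> l_hom G H"
  shows "preorder_ker G (\<lambda>x y. R (h x) (h y)) = {x \<in> carrier G. h x \<in> preorder_ker H R}"
  using l_hom_one[OF assms] by (auto simp: preorder_ker_def l_hom_closed[OF assms(3)])

lemma prime_preorder_leq: "o_group K \<Longrightarrow> prime_preorder K (leq K)"
proof -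
  assume "o_group K"
  then interpret o_group K .
  interpret l_group K by (rule o_group_l_group) fact
  show ?thesis
  proof
    fix x y z assume "x \<in> carrier K" "y \<in> carrier K" "z \<in> carrier K" "x \<preceq>\<^bsub>K\<^esub> y" "y \<preceq>\<^bsub>K\<^esub> z"
    then show "x \<preceq>\<^bsub>K\<^esub> z" using leq_trans by blast
  qed (use tot.total_order_total in \<open>simp_all add: translate_right jn_least\<close>)
qed

lemma left_invariant_leq: "l_group K \<Longrightarrow> left_invariant K (leq K)"
  by (simp add: left_invariant_def l_group.translate_left)

lemma preorder_ker_leq: "l_group K \<Longrightarrow> preorder_ker K (leq K) = {\<one>\<^bsub>K\<^esub>}"
proof -
  assume "l_group K"
  then interpret l_group K .
  show ?thesis by (auto simp: preorder_ker_def leq_refl intro: leq_antisym)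
qed

text \<open>Lives on \<open>'a set\<close>, the type that \<open>representable\<close> prescribes
  for the factors.\<close>

definition quotient_pogroup :: "('a, 'm) pogroup_scheme \<Rightarrow> 'a set \<Rightarrow> 'a set pogroup" where
  "quotient_pogroup G P = \<lparr>carrier = rcosets\<^bsub>G\<^esub> P, mult = set_mult G, one = P, leq = le (coset_poset G P)\<rparr>"

text \<open>For \<open>x\<close> in the kernel, left invariance makes \<open>g \<otimes> x\<close>
  equivalent to \<open>g\<close>, so the conjugate of \<open>x\<close> by \<open>g\<close> is in the
  kernel. The kernel is therefore normal, and \<open>R\<close> becomes a translation invariant total
  order on the quotient.\<close>

lemma (in prime_preorder) left_invariant_quotient:
  assumes left: "left_invariant G R"
  defines "P \<equiv> preorder_ker G R"
  shows "o_group (quotient_pogroup G P)"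
    and "(\<lambda>x. P #> x) \<in> l_hom G (quotient_pogroup G P)"
    and "(\<lambda>x. P #> x) ` carrier G = carrier (quotient_pogroup G P)"
proof -
  let ?Q = "quotient_pogroup G P"
  have "g \<otimes> x \<otimes> inv g \<in> P" if g: "g \<in> carrier G" and x: "x \<in> P" for g x
  proof -
    have "R (g \<otimes> x) (g \<otimes> \<one>)" "R (g \<otimes> \<one>) (g \<otimes> x)" "x \<in> carrier G"
      using left x g one_closed unfolding left_invariant_def P_def preorder_ker_def by blast+
    then show ?thesis using equivalent_iff_ker[of "g \<otimes> x" g] g by (simp add: P_def)
  qed
  then have "P \<lhd> G" using subgroup_ker by (simp add: normal_inv_iff P_def)
  then interpret normal P G .
  have "group (G Mod P)" by (rule factorgroup_is_group)
  then have gr: "group ?Q"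
    by (simp add: group_def monoid_def group_axioms_def Units_def FactGroup_def quotient_pogroup_def)
  have carrier: "carrier ?Q = (\<lambda>x. P #> x) ` carrier G"
    by (auto simp: quotient_pogroup_def RCOSETS_def)
  then show "(\<lambda>x. P #> x) ` carrier G = carrier ?Q" by simp
  have mult: "(P #> x) \<otimes>\<^bsub>?Q\<^esub> (P #> y) = P #> (x \<otimes> y)" if "x \<in> carrier G" "y \<in> carrier G" for x y
    using rcos_sum[OF that] by (simp add: quotient_pogroup_def)
  have leq: "leq ?Q (P #> x) (P #> y) \<longleftrightarrow> R x y" if "x \<in> carrier G" "y \<in> carrier G" for x y
    using le_coset_poset_ker[OF that] by (simp add: quotient_pogroup_def P_def)
  have eq: "P #> x = P #> y \<longleftrightarrow> R x y \<and> R y x" if "x \<in> carrier G" "y \<in> carrier G" for x y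
    using coset_eq_iff[OF that] by (simp add: P_def)
  have "po_group ?Q"
  proof (rule po_groupI[OF gr], unfold carrier)
    fix A assume "A \<in> (\<lambda>x. P #> x) ` carrier G"
    then show "leq ?Q A A" by (auto simp: leq R_refl)
  next
    fix A B assume "A \<in> (\<lambda>x. P #> x) ` carrier G" "B \<in> (\<lambda>x. P #> x) ` carrier G"
      "leq ?Q A B" "leq ?Q B A"
    then show "A = B" by (force simp: leq eq)
  next
    fix A B C assume "A \<in> (\<lambda>x. P #> x) ` carrier G" "B \<in> (\<lambda>x. P #> x) ` carrier G"
      "C \<in> (\<lambda>x. P #> x) ` carrier G"
    then obtain a b c where abc: "a \<in> carrier G" "b \<in> carrier G" "c \<in> carrier G"
      "A = P #> a" "B = P #> b" "C = P #> c" by blast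
    show "leq ?Q A C" if "leq ?Q A B" "leq ?Q B C"
      using that abc R_trans[of a b c] by (simp add: leq)
    show "leq ?Q (C \<otimes>\<^bsub>?Q\<^esub> A) (C \<otimes>\<^bsub>?Q\<^esub> B)" if "leq ?Q A B"
      using that abc left by (simp add: leq mult left_invariant_def)
    show "leq ?Q (A \<otimes>\<^bsub>?Q\<^esub> C) (B \<otimes>\<^bsub>?Q\<^esub> C)" if "leq ?Q A B"
      using that abc by (simp add: leq mult R_mult)
  qed
  then show o: "o_group ?Q"
  proof (rule o_groupI, unfold carrier)
    fix A B assume "A \<in> (\<lambda>x. P #> x) ` carrier G" "B \<in> (\<lambda>x. P #> x) ` carrier G"
    then show "leq ?Q A B \<or> leq ?Q B A" using R_total leq by fastforce
  qed
  interpret Q: l_group ?Q by (rule o_group_l_group) fact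
  show "(\<lambda>x. P #> x) \<in> l_hom G ?Q"
  proof (rule l_homI)
    show "(\<lambda>x. P #> x) \<in> hom G ?Q" by (rule homI) (simp_all add: carrier mult)
    fix x y assume xy: "x \<in> carrier G" "y \<in> carrier G"
    show "P #> (x \<or>\<^sub>l y) = (P #> x) \<squnion>\<^bsub>poset_of ?Q\<^esub> (P #> y)"
      by (rule Q.jn_eqI[symmetric])
        (use xy in \<open>auto simp: carrier leq jn_closed R_leq jn_left jn_right R_jn\<close>)
  qed unfold_locales
qed

text \<open>An internal criterion that does not mention factors. The orders of the factors are
  pulled back along the coordinate maps; conversely, the quotients by the kernels serve as
  factors.\<close>

lemma representable_iff:
  "representable H \<longleftrightarrow> l_group H \<and>
     (\<forall>x\<in>carrier H. x \<noteq> \<one>\<^bsub>H\<^esub> \<longrightarrow> (\<exists>R. prime_preorder H R \<and> left_invariant H R \<and> x \<notin> preorder_ker H R))"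
    (is "_ \<longleftrightarrow> _ \<and> ?sep")
proof (intro iffI conjI)
  assume rep: "representable H"
  then show H: "l_group H" by (simp add: representable_def)
  interpret l_group H by fact
  obtain I :: "'a set set" and K :: "'a set \<Rightarrow> 'a set pogroup" and \<pi> :: "'a set \<Rightarrow> 'a \<Rightarrow> 'a set" where
    K: "\<forall>i\<in>I. o_group (K i) \<and> \<pi> i \<in> l_hom H (K i) \<and> \<pi> i ` carrier H = carrier (K i)"
    and inj: "\<forall>x\<in>carrier H. \<forall>y\<in>carrier H. (\<forall>i\<in>I. \<pi> i x = \<pi> i y) \<longrightarrow> x = y"
    using rep unfolding representable_def by (elim conjE exE)
  show ?sep
  proof (intro ballI impI)
    fix x assume x: "x \<in> carrier H" "x \<noteq> \<one>\<^bsub>H\<^esub>"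
    then obtain i where i: "i \<in> I" "\<pi> i x \<noteq> \<pi> i \<one>\<^bsub>H\<^esub>" using inj by blast
    then have o: "o_group (K i)" and h: "\<pi> i \<in> l_hom H (K i)" using K by auto
    have l: "l_group (K i)" by (rule o_group_l_group[OF o])
    show "\<exists>R. prime_preorder H R \<and> left_invariant H R \<and> x \<notin> preorder_ker H R"
      using prime_preorder_pullback[OF H prime_preorder_leq[OF o] h]
        left_invariant_pullback[OF left_invariant_leq[OF l] h H]
        preorder_ker_pullback[OF H l h, of "leq (K i)"] preorder_ker_leq[OF l] l_hom_one[OF H l h] i(2)
      by (intro exI[of _ "\<lambda>x y. leq (K i) (\<pi> i x) (\<pi> i y)"]) auto
  qed
next
  assume "l_group H \<and> ?sep"
  then have sep: ?sep and "l_group H" by auto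
  interpret l_group H by fact
  \<comment> \<open>The kernels index their own quotients, which fits the index type
    \<open>'a set\<close>.\<close>
  let ?I = "{preorder_ker H R | R. prime_preorder H R \<and> left_invariant H R}"
  have "x = y" if x: "x \<in> carrier H" and y: "y \<in> carrier H" and eq: "\<forall>P\<in>?I. P #>\<^bsub>H\<^esub> x = P #>\<^bsub>H\<^esub> y" for x y
  proof (rule ccontr)
    assume "x \<noteq> y"
    then have "x \<otimes>\<^bsub>H\<^esub> inv\<^bsub>H\<^esub> y \<noteq> \<one>\<^bsub>H\<^esub>" using x y inv_equality[of x "inv\<^bsub>H\<^esub> y"] by auto
    then obtain R where R: "prime_preorder H R" "left_invariant H R" "x \<otimes>\<^bsub>H\<^esub> inv\<^bsub>H\<^esub> y \<notin> preorder_ker H R"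
      using sep x y by blast
    then have "preorder_ker H R #>\<^bsub>H\<^esub> x = preorder_ker H R #>\<^bsub>H\<^esub> y" using eq by blast
    then show False
      using R(3) x y prime_preorder.coset_eq_iff[OF R(1)] prime_preorder.equivalent_iff_ker[OF R(1)] by simp
  qed
  moreover have "o_group (quotient_pogroup H P) \<and> (\<lambda>x. P #>\<^bsub>H\<^esub> x) \<in> l_hom H (quotient_pogroup H P) \<and>
      (\<lambda>x. P #>\<^bsub>H\<^esub> x) ` carrier H = carrier (quotient_pogroup H P)" if "P \<in> ?I" for P
    using that prime_preorder.left_invariant_quotient by blast
  ultimately show "representable H"
    unfolding representable_def using \<open>l_group H\<close>
    by (intro conjI exI[of _ ?I] exI[of _ "quotient_pogroup H"] exI[of _ "\<lambda>P x. P #>\<^bsub>H\<^esub> x"]) blast+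
qed

text \<open>A copy of the substructure on \<open>M\<close> along an injective \<open>c\<close>. It
  moves groups into the type of the test objects; with the identity as \<open>c\<close> it restricts
  a group to \<open>M\<close>.\<close>

definition transport :: "('a \<Rightarrow> 'b) \<Rightarrow> ('a, 'm) pogroup_scheme \<Rightarrow> 'a set \<Rightarrow> 'b pogroup" where
  "transport c G M = \<lparr>carrier = c ` M,
     mult = (\<lambda>x y. c (inv_into M c x \<otimes>\<^bsub>G\<^esub> inv_into M c y)), one = c \<one>\<^bsub>G\<^esub>,
     leq = (\<lambda>x y. inv_into M c x \<preceq>\<^bsub>G\<^esub> inv_into M c y)\<rparr>"

text \<open>Closure under meets follows from closure under joins and inverses.\<close>

locale sub_l_group = l_group G for G :: "('a, 'm) pogroup_scheme" (structure) +
  fixes M :: "'a set"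
  assumes sub: "subgroup M G"
    and sub_jn: "\<lbrakk>x \<in> M; y \<in> M\<rbrakk> \<Longrightarrow> x \<or>\<^sub>l y \<in> M"
begin

lemma MG: "x \<in> M \<Longrightarrow> x \<in> carrier G"
  by (rule subgroup.mem_carrier[OF sub])

context
  fixes c :: "'a \<Rightarrow> 'b"
  assumes inj: "inj_on c M"
begin

lemma transport_carrier: "carrier (transport c G M) = c ` M"
  by (simp add: transport_def)

lemma transport_mult: "\<lbrakk>x \<in> M; y \<in> M\<rbrakk> \<Longrightarrow> c x \<otimes>\<^bsub>transport c G M\<^esub> c y = c (x \<otimes> y)"
  using inj by (simp add: transport_def)

lemma transport_leq: "\<lbrakk>x \<in> M; y \<in> M\<rbrakk> \<Longrightarrow> c x \<preceq>\<^bsub>transport c G M\<^esub> c y \<longleftrightarrow> x \<preceq> y"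
  using inj by (simp add: transport_def)

lemma transport_one: "\<one>\<^bsub>transport c G M\<^esub> = c \<one>"
  by (simp add: transport_def)

lemma po_group_transport: "po_group (transport c G M)"
proof (rule po_groupI)
  note [simp] = transport_carrier transport_mult transport_leq transport_one MG
    subgroup.one_closed[OF sub] subgroup.m_closed[OF sub] subgroup.m_inv_closed[OF sub]
  show "group (transport c G M)"
  proof (rule groupI)
    fix A assume "A \<in> carrier (transport c G M)"
    then obtain a where a: "a \<in> M" "A = c a" by auto
    then show "\<exists>y\<in>carrier (transport c G M). y \<otimes>\<^bsub>transport c G M\<^esub> A = \<one>\<^bsub>transport c G M\<^esub>"
      by (auto intro!: bexI[of _ "inv a"])
  qed (auto simp: m_assoc)
  fix A B C
  assume ABC: "A \<in> carrier (transport c G M)" "B \<in> carrier (transport c G M)" "C \<in> carrier (transport c G M)"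
  then obtain x y z where xyz: "x \<in> M" "y \<in> M" "z \<in> M" and eq: "A = c x" "B = c y" "C = c z" by auto
  show "A \<preceq>\<^bsub>transport c G M\<^esub> C" if "A \<preceq>\<^bsub>transport c G M\<^esub> B" "B \<preceq>\<^bsub>transport c G M\<^esub> C"
    using that xyz leq_trans[of x y z] by (simp add: eq)
  show "C \<otimes>\<^bsub>transport c G M\<^esub> A \<preceq>\<^bsub>transport c G M\<^esub> C \<otimes>\<^bsub>transport c G M\<^esub> B" if "A \<preceq>\<^bsub>transport c G M\<^esub> B"
    using that xyz by (simp add: eq translate_left)
  show "A \<otimes>\<^bsub>transport c G M\<^esub> C \<preceq>\<^bsub>transport c G M\<^esub> B \<otimes>\<^bsub>transport c G M\<^esub> C" if "A \<preceq>\<^bsub>transport c G M\<^esub> B"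
    using that xyz by (simp add: eq translate_right)
next
  fix A B
  assume "A \<in> carrier (transport c G M)" "B \<in> carrier (transport c G M)"
    "A \<preceq>\<^bsub>transport c G M\<^esub> B" "B \<preceq>\<^bsub>transport c G M\<^esub> A"
  then obtain x y where "x \<in> M" "y \<in> M" "A = c x" "B = c y" "x \<preceq> y" "y \<preceq> x"
    by (auto simp: transport_carrier transport_leq)
  then show "A = B" using leq_antisym[of x y] by (simp add: MG)
qed (auto simp: transport_carrier transport_leq MG leq_refl)

lemma l_group_transport: "l_group (transport c G M)"
proof (rule l_groupI[OF po_group_transport])
  fix A B assume "A \<in> carrier (transport c G M)" "B \<in> carrier (transport c G M)"
  then obtain x y where "x \<in> M" "y \<in> M" "A = c x" "B = c y" by (auto simp: transport_carrier)
  then show "\<exists>s\<in>carrier (transport c G M). A \<preceq>\<^bsub>transport c G M\<^esub> s \<and> B \<preceq>\<^bsub>transport c G M\<^esub> s \<and>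
      (\<forall>z\<in>carrier (transport c G M). A \<preceq>\<^bsub>transport c G M\<^esub> z \<and> B \<preceq>\<^bsub>transport c G M\<^esub> z \<longrightarrow> s \<preceq>\<^bsub>transport c G M\<^esub> z)"
    by (intro bexI[of _ "c (x \<or>\<^sub>l y)"])
      (auto simp: transport_carrier transport_leq MG sub_jn jn_left jn_right jn_least)
qed

lemma transport_jn:
  assumes "x \<in> M" "y \<in> M"
  shows "c x \<squnion>\<^bsub>poset_of (transport c G M)\<^esub> c y = c (x \<or>\<^sub>l y)"
  by (rule l_group.jn_eqI[OF l_group_transport])
    (use assms in \<open>auto simp: transport_carrier transport_leq MG sub_jn jn_left jn_right jn_least\<close>)

lemma inv_into_l_hom: "inv_into M c \<in> l_hom (transport c G M) G"
proof (rule l_homI[OF l_group_transport])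
  show "l_group G" by unfold_locales
  show "inv_into M c \<in> hom (transport c G M) G"
    by (rule homI) (auto simp: transport_carrier transport_mult inj MG subgroup.m_closed[OF sub])
  fix A B assume "A \<in> carrier (transport c G M)" "B \<in> carrier (transport c G M)"
  then show "inv_into M c (A \<squnion>\<^bsub>poset_of (transport c G M)\<^esub> B) = inv_into M c A \<or>\<^sub>l inv_into M c B"
    by (auto simp: transport_carrier transport_jn inj sub_jn)
qed

text \<open>In the representable case the separating preorders are pulled back along
  \<open>inv_into M c\<close>, by the criterion \<open>representable_iff\<close>.\<close>

lemma in_variety_transport:
  assumes "in_variety V G"
  shows "in_variety V (transport c G M)"
proof (cases V)
  case All_l_groups
  then show ?thesis by (simp add: l_group_transport)
next
  case Abelian_l_groups
  then have "comm_group G" using assms by simp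
  then have "x \<otimes> y = y \<otimes> x" if "x \<in> M" "y \<in> M" for x y
    using that comm_monoid.m_comm[of G x y] by (simp add: MG comm_group_def)
  then have "comm_group (transport c G M)"
    using po_group_transport unfolding po_group_def
    by (intro group.group_comm_groupI) (auto simp: transport_carrier transport_mult)
  then show ?thesis using Abelian_l_groups l_group_transport by simp
next
  case Representable_l_groups
  then have rep: "representable G" using assms by simp
  have G: "l_group G" by unfold_locales
  have "representable (transport c G M)"
    unfolding representable_iff
  proof (intro conjI ballI impI)
    show "l_group (transport c G M)" by (rule l_group_transport)
    fix A assume "A \<in> carrier (transport c G M)" "A \<noteq> \<one>\<^bsub>transport c G M\<^esub>"
    then obtain x where x: "x \<in> M" "A = c x" "x \<noteq> \<one>" by (auto simp: transport_carrier transport_one)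
    then obtain R where R: "prime_preorder G R" "left_invariant G R" "x \<notin> preorder_ker G R"
      using rep MG unfolding representable_iff by blast
    show "\<exists>R. prime_preorder (transport c G M) R \<and> left_invariant (transport c G M) R \<and>
        A \<notin> preorder_ker (transport c G M) R"
      using prime_preorder_pullback[OF l_group_transport R(1) inv_into_l_hom]
        left_invariant_pullback[OF R(2) inv_into_l_hom l_group_transport]
        preorder_ker_pullback[OF l_group_transport G inv_into_l_hom, of R] R(3) x inj
      by (intro exI[of _ "\<lambda>x y. R (inv_into M c x) (inv_into M c y)"]) auto
  qed
  then show ?thesis using Representable_l_groups by simp
qed

end

end

section \<open>Automorphism groups of chains\<close>

locale chain =
  fixes W :: "'a set" and r :: "'a \<Rightarrow> 'a \<Rightarrow> bool"
  assumes r_total: "\<lbrakk>x \<in> W; y \<in> W\<rbrakk> \<Longrightarrow> r x y \<or> r y x"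
    and r_antisym: "\<lbrakk>x \<in> W; y \<in> W; r x y; r y x\<rbrakk> \<Longrightarrow> x = y"
    and r_trans: "\<lbrakk>x \<in> W; y \<in> W; z \<in> W; r x y; r y z\<rbrakk> \<Longrightarrow> r x z"

text \<open>The group acts on the chain from the right, so that point evaluations give right invariant preorders.\<close>

definition chain_aut :: "'a set \<Rightarrow> ('a \<Rightarrow> 'a \<Rightarrow> bool) \<Rightarrow> ('a \<Rightarrow> 'a) pogroup" where
  "chain_aut W r = \<lparr>carrier = {f. bij_betw f W W \<and> (\<forall>x. x \<notin> W \<longrightarrow> f x = x) \<and>
      (\<forall>x\<in>W. \<forall>y\<in>W. r x y \<longrightarrow> r (f x) (f y))},
     mult = (\<lambda>f g. g \<circ> f), one = id, leq = (\<lambda>f g. \<forall>x\<in>W. r (f x) (g x))\<rparr>"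

context chain
begin

lemma r_refl: "x \<in> W \<Longrightarrow> r x x"
  using r_total by blast

lemma aut_mem: "\<lbrakk>f \<in> carrier (chain_aut W r); x \<in> W\<rbrakk> \<Longrightarrow> f x \<in> W"
  by (auto simp: chain_aut_def bij_betw_def)

lemma aut_iff:
  assumes f: "f \<in> carrier (chain_aut W r)" and x: "x \<in> W" and y: "y \<in> W"
  shows "r (f x) (f y) \<longleftrightarrow> r x y"
proof
  assume fr: "r (f x) (f y)"
  show "r x y"
  proof (rule ccontr)
    assume n: "\<not> r x y"
    then have "r y x" using r_total x y by blast
    then have "r (f y) (f x)" using f x y by (auto simp: chain_aut_def)
    then have "f x = f y" using fr r_antisym aut_mem[OF f] x y by blast
    then have "x = y" using f x y by (auto simp: chain_aut_def bij_betw_def inj_on_def)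
    then show False using n r_refl x by simp
  qed
qed (use f x y in \<open>auto simp: chain_aut_def\<close>)

lemma aut_surj:
  assumes f: "f \<in> carrier (chain_aut W r)" and y: "y \<in> W"
  obtains x where "x \<in> W" "f x = y"
proof -
  have "y \<in> f ` W" using f y by (simp add: chain_aut_def bij_betw_def)
  then show ?thesis using that by blast
qed

lemma autI:
  assumes "\<And>x. x \<in> W \<Longrightarrow> f x \<in> W" "\<And>x. x \<notin> W \<Longrightarrow> f x = x"
    and surj: "\<And>y. y \<in> W \<Longrightarrow> \<exists>x\<in>W. f x = y"
    and mono: "\<And>x y. \<lbrakk>x \<in> W; y \<in> W\<rbrakk> \<Longrightarrow> r (f x) (f y) \<longleftrightarrow> r x y"
  shows "f \<in> carrier (chain_aut W r)"
proof -
  have "inj_on f W"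
  proof (rule inj_onI)
    fix x y assume "x \<in> W" "y \<in> W" "f x = f y"
    then show "x = y" using mono[of x y] mono[of y x] r_refl[of "f x"] assms(1)[of x] r_antisym[of x y] by auto
  qed
  moreover have "f ` W = W" using assms(1) surj by blast
  ultimately show ?thesis using assms(2) mono by (simp add: chain_aut_def bij_betw_def)
qed

lemma aut_ext:
  assumes "f \<in> carrier (chain_aut W r)" "g \<in> carrier (chain_aut W r)" "\<And>x. x \<in> W \<Longrightarrow> f x = g x"
  shows "f = g"
proof
  fix x show "f x = g x" using assms by (cases "x \<in> W") (auto simp: chain_aut_def)
qed

lemma chain_aut_mult: "f \<otimes>\<^bsub>chain_aut W r\<^esub> g = g \<circ> f"
  by (simp add: chain_aut_def)

lemma chain_aut_leq: "f \<preceq>\<^bsub>chain_aut W r\<^esub> g \<longleftrightarrow> (\<forall>x\<in>W. r (f x) (g x))"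
  by (simp add: chain_aut_def)

lemma group_chain_aut: "group (chain_aut W r)"
proof (rule groupI)
  fix f g assume f: "f \<in> carrier (chain_aut W r)" and g: "g \<in> carrier (chain_aut W r)"
  show "f \<otimes>\<^bsub>chain_aut W r\<^esub> g \<in> carrier (chain_aut W r)"
    unfolding chain_aut_mult
  proof (rule autI)
    fix y assume "y \<in> W"
    then show "\<exists>x\<in>W. (g \<circ> f) x = y" by (metis aut_surj f g comp_apply)
  next
    fix x y assume "x \<in> W" "y \<in> W"
    then show "r ((g \<circ> f) x) ((g \<circ> f) y) \<longleftrightarrow> r x y" by (simp add: aut_iff f g aut_mem)
  qed (use f g in \<open>auto simp: aut_mem chain_aut_def\<close>)
next
  fix f assume f: "f \<in> carrier (chain_aut W r)"
  let ?g = "\<lambda>x. if x \<in> W then inv_into W f x else x"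
  have bij: "bij_betw f W W" using f by (simp add: chain_aut_def)
  then have fg: "f (inv_into W f x) = x" "inv_into W f x \<in> W" "inv_into W f (f x) = x" if "x \<in> W" for x
    using that by (auto simp: bij_betw_def f_inv_into_f inv_into_into)
  have "?g \<in> carrier (chain_aut W r)"
  proof (rule autI)
    fix y assume y: "y \<in> W"
    show "\<exists>x\<in>W. ?g x = y" using fg[OF y] aut_mem[OF f y] y by (intro bexI[of _ "f y"]) auto
  next
    fix x y assume "x \<in> W" "y \<in> W"
    then show "r (?g x) (?g y) \<longleftrightarrow> r x y"
      using aut_iff[OF f, of "inv_into W f x" "inv_into W f y"] by (simp add: fg)
  qed (auto simp: fg)
  moreover have "f (?g x) = x" for x using fg f by (simp add: chain_aut_def)
  then have "?g \<otimes>\<^bsub>chain_aut W r\<^esub> f = \<one>\<^bsub>chain_aut W r\<^esub>"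
    by (auto simp: chain_aut_def fun_eq_iff)
  ultimately show "\<exists>g\<in>carrier (chain_aut W r). g \<otimes>\<^bsub>chain_aut W r\<^esub> f = \<one>\<^bsub>chain_aut W r\<^esub>" by blast
qed (auto simp: chain_aut_def)

lemma po_group_chain_aut: "po_group (chain_aut W r)"
proof (rule po_groupI[OF group_chain_aut], unfold chain_aut_leq chain_aut_mult)
  fix f g h
  assume fgh: "f \<in> carrier (chain_aut W r)" "g \<in> carrier (chain_aut W r)" "h \<in> carrier (chain_aut W r)"
  show "\<forall>x\<in>W. r (f x) (h x)" if "\<forall>x\<in>W. r (f x) (g x)" "\<forall>x\<in>W. r (g x) (h x)"
    using that fgh aut_mem r_trans by meson
  show "\<forall>x\<in>W. r ((f \<circ> h) x) ((g \<circ> h) x)" if "\<forall>x\<in>W. r (f x) (g x)"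
    using that fgh aut_mem by simp
  show "\<forall>x\<in>W. r ((h \<circ> f) x) ((h \<circ> g) x)" if "\<forall>x\<in>W. r (f x) (g x)"
    using that fgh aut_mem aut_iff by simp
next
  fix f g
  assume fg: "f \<in> carrier (chain_aut W r)" "g \<in> carrier (chain_aut W r)"
    "\<forall>x\<in>W. r (f x) (g x)" "\<forall>x\<in>W. r (g x) (f x)"
  then show "f = g" using aut_mem by (intro aut_ext) (auto intro: r_antisym)
qed (auto intro: r_refl aut_mem)

definition pointwise_max :: "('a \<Rightarrow> 'a) \<Rightarrow> ('a \<Rightarrow> 'a) \<Rightarrow> 'a \<Rightarrow> 'a" where
  "pointwise_max f g x = (if r (f x) (g x) then g x else f x)"

lemma pointwise_max_aut:
  assumes f: "f \<in> carrier (chain_aut W r)" and g: "g \<in> carrier (chain_aut W r)"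
  shows "pointwise_max f g \<in> carrier (chain_aut W r)"
proof (rule autI)
  note [simp] = aut_mem[OF f] aut_mem[OF g]
  show "pointwise_max f g x \<in> W" if "x \<in> W" for x using that by (simp add: pointwise_max_def)
  show "pointwise_max f g x = x" if "x \<notin> W" for x
    using that f g by (simp add: pointwise_max_def chain_aut_def)
  have mono: "r (pointwise_max f g x) (pointwise_max f g y)" if "x \<in> W" "y \<in> W" "r x y" for x y
  proof -
    have "r (f x) (f y)" "r (g x) (g y)" using that aut_iff f g by blast+
    then show ?thesis
      using that r_total[of "f x" "g x"] r_total[of "f y" "g y"]
        r_trans[of "f x" "f y" "g y"] r_trans[of "g x" "g y" "f y"]
      unfolding pointwise_max_def by auto
  qed
  have strict: "r y x" if x: "x \<in> W" and y: "y \<in> W" and eq: "r (pointwise_max f g y) (pointwise_max f g x)" for x y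
  proof (rule ccontr)
    assume n: "\<not> r y x"
    then have "\<not> r (f y) (f x)" "\<not> r (g y) (g x)" using aut_iff f g x y by blast+
    then have "\<not> r (pointwise_max f g y) (pointwise_max f g x)"
      using x y r_total[of "f y" "g y"] r_trans[of "f y" "g y" "f x"] r_trans[of "g y" "f y" "g x"]
        r_trans[of "f y" "g y" "g x"]
      unfolding pointwise_max_def by auto
    then show False using eq by simp
  qed
  show "r (pointwise_max f g x) (pointwise_max f g y) \<longleftrightarrow> r x y" if "x \<in> W" "y \<in> W" for x y
    using mono strict that by blast
  fix y assume y: "y \<in> W"
  \<comment> \<open>The smaller of the preimages of \<open>y\<close> under \<open>f\<close> and
    under \<open>g\<close> is a preimage under the pointwise maximum.\<close>
  obtain a where a: "a \<in> W" "f a = y" by (rule aut_surj[OF f y])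
  obtain b where b: "b \<in> W" "g b = y" by (rule aut_surj[OF g y])
  show "\<exists>x\<in>W. pointwise_max f g x = y"
  proof (cases "r a b")
    case True
    then have "r (g a) (f a)" using aut_iff[OF g a(1) b(1)] a b by simp
    then have "pointwise_max f g a = y"
      using a r_antisym[of "f a" "g a"] by (auto simp: pointwise_max_def)
    then show ?thesis using a by blast
  next
    case False
    then have "r (f b) (g b)" using aut_iff[OF f b(1) a(1)] r_total[of a b] a b by simp
    then have "pointwise_max f g b = y" using b by (simp add: pointwise_max_def)
    then show ?thesis using b by blast
  qed
qed

lemma pointwise_max_least:
  assumes f: "f \<in> carrier (chain_aut W r)" and g: "g \<in> carrier (chain_aut W r)" and x: "x \<in> W"
  shows "r (f x) (pointwise_max f g x)" "r (g x) (pointwise_max f g x)"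
    "\<lbrakk>r (f x) y; r (g x) y\<rbrakk> \<Longrightarrow> r (pointwise_max f g x) y"
  using r_total[of "f x" "g x"] aut_mem[OF f x] aut_mem[OF g x] r_refl
  by (auto simp: pointwise_max_def)

lemma l_group_chain_aut: "l_group (chain_aut W r)"
proof (rule l_groupI[OF po_group_chain_aut])
  fix f g assume fg: "f \<in> carrier (chain_aut W r)" "g \<in> carrier (chain_aut W r)"
  show "\<exists>s\<in>carrier (chain_aut W r). f \<preceq>\<^bsub>chain_aut W r\<^esub> s \<and> g \<preceq>\<^bsub>chain_aut W r\<^esub> s \<and>
      (\<forall>z\<in>carrier (chain_aut W r). f \<preceq>\<^bsub>chain_aut W r\<^esub> z \<and> g \<preceq>\<^bsub>chain_aut W r\<^esub> z \<longrightarrow> s \<preceq>\<^bsub>chain_aut W r\<^esub> z)"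
    using pointwise_max_aut[OF fg] pointwise_max_least[OF fg]
    by (intro bexI[of _ "pointwise_max f g"]) (auto simp: chain_aut_leq)
qed

lemma chain_aut_jn:
  assumes fg: "f \<in> carrier (chain_aut W r)" "g \<in> carrier (chain_aut W r)"
  shows "f \<squnion>\<^bsub>poset_of (chain_aut W r)\<^esub> g = pointwise_max f g"
  using pointwise_max_aut[OF fg] pointwise_max_least[OF fg] fg
  by (intro l_group.jn_eqI[OF l_group_chain_aut]) (auto simp: chain_aut_leq)

text \<open>The product of \<open>f\<close> and \<open>h\<close> sends \<open>w\<close> to
  \<open>h (f w)\<close>, so right invariance holds because \<open>h\<close> is an order
  automorphism. The lattice condition holds because joins are pointwise maxima.\<close>

lemma prime_preorder_point:
  assumes w: "w \<in> W"
  shows "prime_preorder (chain_aut W r) (\<lambda>f g. r (f w) (g w))"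
proof -
  interpret l_group "chain_aut W r" by (rule l_group_chain_aut)
  show ?thesis
  proof
    fix f g assume fg: "f \<in> carrier (chain_aut W r)" "g \<in> carrier (chain_aut W r)"
    then show "r (f w) (g w) \<or> r (g w) (f w)" using w by (simp add: r_total aut_mem)
    show "r (f w) (g w)" if "f \<preceq>\<^bsub>chain_aut W r\<^esub> g" using that w by (simp add: chain_aut_leq)
    fix h assume h: "h \<in> carrier (chain_aut W r)"
    show "r (f w) (h w)" if "r (f w) (g w)" "r (g w) (h w)"
      using that fg h w r_trans[of "f w" "g w" "h w"] by (simp add: aut_mem)
    show "r ((f \<otimes>\<^bsub>chain_aut W r\<^esub> h) w) ((g \<otimes>\<^bsub>chain_aut W r\<^esub> h) w)" if "r (f w) (g w)"
      using that fg h w by (simp add: chain_aut_mult aut_iff aut_mem)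
    show "r ((f \<squnion>\<^bsub>poset_of (chain_aut W r)\<^esub> g) w) (h w)" if "r (f w) (h w)" "r (g w) (h w)"
      using that fg w pointwise_max_least(3)[OF fg w] by (simp add: chain_aut_jn)
  qed
qed

end

section \<open>Right preorders on a partially ordered group\<close>

text \<open>What a prime preorder on \<open>F\<close> leaves on \<open>G\<close>: the conditions
  that do not involve joins.\<close>

locale right_preorder = po_group G for G :: "('a, 'm) pogroup_scheme" (structure) +
  fixes S :: "'a \<Rightarrow> 'a \<Rightarrow> bool"
  assumes S_total: "\<lbrakk>x \<in> carrier G; y \<in> carrier G\<rbrakk> \<Longrightarrow> S x y \<or> S y x"
    and S_trans: "\<lbrakk>x \<in> carrier G; y \<in> carrier G; z \<in> carrier G; S x y; S y z\<rbrakk> \<Longrightarrow> S x z"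
    and S_mult: "\<lbrakk>x \<in> carrier G; y \<in> carrier G; z \<in> carrier G; S x y\<rbrakk> \<Longrightarrow> S (x \<otimes> z) (y \<otimes> z)"
    and S_leq: "\<lbrakk>x \<in> carrier G; y \<in> carrier G; x \<preceq> y\<rbrakk> \<Longrightarrow> S x y"

lemma sub_l_groupI:
  assumes "l_group G" "subgroup M G" "\<And>x y. \<lbrakk>x \<in> M; y \<in> M\<rbrakk> \<Longrightarrow> x \<squnion>\<^bsub>poset_of G\<^esub> y \<in> M"
  shows "sub_l_group G M"
  using assms by (simp add: sub_l_group_def sub_l_group_axioms_def)

lemma (in l_group) sub_l_group_carrier: "sub_l_group G (carrier G)"
  by (rule sub_l_groupI[OF l_group_axioms subgroup_self jn_closed])

text \<open>Points name the equivalence classes of \<open>S\<close> by values of a free type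
  \<open>'b\<close>, so that the chain can later be placed in the type underlying the test
  objects.\<close>

locale point_action = right_preorder G S for G :: "('a, 'm) pogroup_scheme" (structure) and S +
  fixes point :: "'a \<Rightarrow> 'b"
  assumes point_eq_iff: "\<lbrakk>x \<in> carrier G; y \<in> carrier G\<rbrakk> \<Longrightarrow> point x = point y \<longleftrightarrow> S x y \<and> S y x"
begin

definition points :: "'b set" where
  "points = point ` carrier G"

definition point_le :: "'b \<Rightarrow> 'b \<Rightarrow> bool" where
  "point_le v w \<longleftrightarrow> (\<exists>x\<in>carrier G. \<exists>y\<in>carrier G. v = point x \<and> w = point y \<and> S x y)"

text \<open>Right multiplication on classes; off the chain it is the identity, as
  \<open>chain_aut\<close> requires.\<close>

definition act :: "'a \<Rightarrow> 'b \<Rightarrow> 'b" where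
  "act g w = (if w \<in> points then point (inv_into (carrier G) point w \<otimes> g) else w)"

lemma pointsE:
  assumes "w \<in> points"
  obtains x where "x \<in> carrier G" "w = point x"
  using assms by (auto simp: points_def)

lemma ball_points: "(\<forall>w\<in>points. P w) \<longleftrightarrow> (\<forall>x\<in>carrier G. P (point x))"
  by (simp add: points_def)

lemma point_le_iff:
  assumes "x \<in> carrier G" "y \<in> carrier G"
  shows "point_le (point x) (point y) \<longleftrightarrow> S x y"
proof
  assume "point_le (point x) (point y)"
  then obtain a b where "a \<in> carrier G" "b \<in> carrier G" "S a b" "S x a" "S b y"
    using assms by (auto simp: point_le_def point_eq_iff)
  then show "S x y" using assms S_trans[of x a b] S_trans[of x b y] by simp
qed (use assms in \<open>auto simp: point_le_def\<close>)

lemma act_point: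
  assumes "x \<in> carrier G" "g \<in> carrier G"
  shows "act g (point x) = point (x \<otimes> g)"
proof -
  let ?y = "inv_into (carrier G) point (point x)"
  have y: "?y \<in> carrier G" "point ?y = point x"
    using assms by (auto intro: inv_into_into f_inv_into_f)
  then show ?thesis
    using assms by (auto simp: act_def points_def point_eq_iff S_mult)
qed

sublocale points: chain points point_le
proof
  fix u v assume "u \<in> points" "v \<in> points"
  then obtain x y where xy: "x \<in> carrier G" "y \<in> carrier G" "u = point x" "v = point y"
    by (auto simp: points_def)
  then show "point_le u v \<or> point_le v u" using S_total by (simp add: point_le_iff)
  show "u = v" if "point_le u v" "point_le v u" using xy that by (simp add: point_le_iff point_eq_iff)
  fix w assume "w \<in> points"
  then obtain z where "z \<in> carrier G" "w = point z" by (auto simp: points_def)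
  then show "point_le u w" if "point_le u v" "point_le v w"
    using xy that S_trans[of x y z] by (simp add: point_le_iff)
qed

lemma act_aut:
  assumes g: "g \<in> carrier G"
  shows "act g \<in> carrier (chain_aut points point_le)"
proof (rule points.autI)
  fix u assume "u \<in> points"
  then obtain x where x: "x \<in> carrier G" "u = point x" by (auto simp: points_def)
  then show "act g u \<in> points" using g by (simp add: act_point) (simp add: points_def)
  have "act g (point (x \<otimes> inv g)) = u" using x g by (simp add: act_point m_assoc)
  then show "\<exists>w\<in>points. act g w = u" using x g by (intro bexI) (auto simp: points_def)
  fix v assume "v \<in> points"
  then obtain y where y: "y \<in> carrier G" "v = point y" by (auto simp: points_def)
  have "S x y" if "S (x \<otimes> g) (y \<otimes> g)"
    using S_mult[of "x \<otimes> g" "y \<otimes> g" "inv g"] x y g that by (simp add: m_assoc)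
  then show "point_le (act g u) (act g v) \<longleftrightarrow> point_le u v"
    using x y g by (auto simp: act_point point_le_iff S_mult)
qed (simp add: act_def)

lemma act_eqI:
  assumes "g \<in> carrier G" "h \<in> carrier G" "\<And>x. x \<in> carrier G \<Longrightarrow> point (x \<otimes> g) = point (x \<otimes> h)"
  shows "act g = act h"
  by (rule points.aut_ext) (use assms in \<open>auto simp: act_aut act_point elim!: pointsE\<close>)

lemma act_hom: "act \<in> hom G (chain_aut points point_le)"
proof (rule homI)
  fix g h assume gh: "g \<in> carrier G" "h \<in> carrier G"
  show "act (g \<otimes> h) = act g \<otimes>\<^bsub>chain_aut points point_le\<^esub> act h"
  proof (rule points.aut_ext)
    show "act g \<otimes>\<^bsub>chain_aut points point_le\<^esub> act h \<in> carrier (chain_aut points point_le)"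
      using points.group_chain_aut gh by (intro monoid.m_closed group.is_monoid act_aut)
    fix w assume "w \<in> points"
    then show "act (g \<otimes> h) w = (act g \<otimes>\<^bsub>chain_aut points point_le\<^esub> act h) w"
      using gh by (auto simp: points.chain_aut_mult act_point m_assoc elim!: pointsE)
  qed (use gh in \<open>simp add: act_aut\<close>)
qed (rule act_aut)

lemma act_leq_iff:
  assumes "g \<in> carrier G" "h \<in> carrier G"
  shows "act g \<preceq>\<^bsub>chain_aut points point_le\<^esub> act h \<longleftrightarrow> (\<forall>x\<in>carrier G. S (x \<otimes> g) (x \<otimes> h))"
  using assms by (simp add: points.chain_aut_leq ball_points act_point point_le_iff)

lemma act_positive: "act \<in> positive_hom G (chain_aut points point_le)"
  by (rule positive_homI[OF _ points.po_group_chain_aut act_hom])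
    (use po_group_axioms translate[where t = \<one>] in \<open>auto simp: act_leq_iff intro!: S_leq\<close>)

text \<open>Left invariance makes \<open>act\<close> monotone from \<open>S\<close>, so the image of
  \<open>G\<close> is totally ordered. A join of two comparable elements is one of them, hence the
  image is closed under joins.\<close>

lemma act_image_l_group:
  assumes left: "left_invariant G S"
  defines "A \<equiv> chain_aut points point_le" and "M \<equiv> act ` carrier G"
  shows "sub_l_group A M" and "o_group (transport (\<lambda>f. f) A M)"
proof -
  interpret A: l_group A unfolding A_def by (rule points.l_group_chain_aut)
  interpret h: group_hom G A act using act_hom by unfold_locales (simp add: A_def)
  have mono: "act g \<preceq>\<^bsub>A\<^esub> act h" if "g \<in> carrier G" "h \<in> carrier G" "S g h" for g h
    using that left by (simp add: A_def act_leq_iff left_invariant_def)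
  have total: "f \<preceq>\<^bsub>A\<^esub> g \<or> g \<preceq>\<^bsub>A\<^esub> f" if "f \<in> M" "g \<in> M" for f g
    using that mono S_total unfolding M_def by blast
  have MA: "f \<in> carrier A" if "f \<in> M" for f
    using that act_aut by (auto simp: A_def M_def)
  show "sub_l_group A M"
  proof (rule sub_l_groupI)
    show "l_group A" by unfold_locales
    show "subgroup M A" unfolding M_def by (rule h.img_is_subgroup)
    fix f g assume fg: "f \<in> M" "g \<in> M"
    from total[OF fg] show "f \<squnion>\<^bsub>poset_of A\<^esub> g \<in> M"
      using fg MA A.jn_absorb[of f g] A.jn_absorb[of g f] by (auto simp: join_comm)
  qed
  then interpret sub_l_group A M .
  have inj: "inj_on (\<lambda>f. f) M" by simp
  show "o_group (transport (\<lambda>f. f) A M)"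
    by (rule o_groupI[OF po_group_transport[OF inj]])
      (use total in \<open>auto simp: transport_carrier[OF inj] transport_leq[OF inj]\<close>)
qed

end

lemma representable_o_group:
  assumes "o_group K"
  shows "representable K"
proof -
  have "l_group K" by (rule o_group_l_group[OF assms])
  then show ?thesis
    using prime_preorder_leq[OF assms] left_invariant_leq[of K] preorder_ker_leq[of K]
    unfolding representable_iff by blast
qed

section \<open>Primes of free lattice-ordered groups\<close>

inductive_set lattice_closure :: "('f, 'm) pogroup_scheme \<Rightarrow> 'f set \<Rightarrow> 'f set" for F X where
  base: "x \<in> X \<Longrightarrow> x \<in> lattice_closure F X"
| jn: "\<lbrakk>x \<in> lattice_closure F X; y \<in> lattice_closure F X\<rbrakk> \<Longrightarrow> x \<squnion>\<^bsub>poset_of F\<^esub> y \<in> lattice_closure F X"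
| mt: "\<lbrakk>x \<in> lattice_closure F X; y \<in> lattice_closure F X\<rbrakk> \<Longrightarrow> x \<sqinter>\<^bsub>poset_of F\<^esub> y \<in> lattice_closure F X"

text \<open>Inversion exchanges joins and meets, and translations preserve both. Products are
  treated by induction on the right factor for a left factor in \<open>X\<close>, and then by
  induction on the left factor.\<close>

lemma (in l_group) sub_l_group_lattice_closure:
  assumes X: "subgroup X G"
  shows "sub_l_group G (lattice_closure G X)"
proof (rule sub_l_groupI[OF l_group_axioms])
  let ?L = "lattice_closure G X"
  have LG: "x \<in> carrier G" if "x \<in> ?L" for x
    using that by induction (auto simp: subgroup.mem_carrier[OF X] jn_closed mt_closed)
  have inv: "inv x \<in> ?L" if "x \<in> ?L" for x
    using that
    by induction (auto simp: subgroup.m_inv_closed[OF X] inv_jn inv_mt LG intro: lattice_closure.intros)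
  have 1: "x \<otimes> y \<in> ?L" if "y \<in> ?L" "x \<in> X" for x y
    using that
    by induction
      (auto simp: subgroup.m_closed[OF X] subgroup.mem_carrier[OF X] jn_mult_left mt_mult_left LG
        intro: lattice_closure.intros)
  have 2: "x \<otimes> y \<in> ?L" if "x \<in> ?L" "y \<in> ?L" for x y
    using that
    by induction (auto simp: 1 jn_mult_right mt_mult_right LG intro: lattice_closure.intros)
  show "subgroup ?L G"
  proof (rule subgroupI)
    show "?L \<subseteq> carrier G" using LG by blast
    show "?L \<noteq> {}" using lattice_closure.base[OF subgroup.one_closed[OF X]] by blast
  qed (fact inv 2)+
qed (rule lattice_closure.jn)

context prime_preorder
begin

lemma equivalent_trans:
  "\<lbrakk>x \<in> carrier G; y \<in> carrier G; z \<in> carrier G; x \<sim> y; y \<sim> z\<rbrakk> \<Longrightarrow> x \<sim> z"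
  using R_trans by blast

lemma R_cong:
  assumes "x \<in> carrier G" "y \<in> carrier G" "x' \<in> carrier G" "y' \<in> carrier G" "x \<sim> x'" "y \<sim> y'"
  shows "R x y \<longleftrightarrow> R x' y'"
  using assms R_trans by meson

text \<open>Modulo a prime preorder joins and meets are maxima and minima. So a representative of
  one argument also represents the result, as \<open>prime_preorder_mono\<close> exploits.\<close>

lemma equivalent_jn_mt:
  assumes xx': "x \<in> carrier G" "x' \<in> carrier G" "x \<sim> x'"
    and yy': "y \<in> carrier G" "y' \<in> carrier G" "y \<sim> y'"
    and R: "R x' y'"
  shows "x \<or>\<^sub>l y \<sim> y'" "x \<and>\<^sub>l y \<sim> x'"
proof -
  have xy: "R x y" using R_cong[OF xx'(1) yy'(1) xx'(2) yy'(2) xx'(3) yy'(3)] R by simp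
  show "x \<or>\<^sub>l y \<sim> y'"
    by (rule equivalent_trans[OF jn_closed[OF xx'(1) yy'(1)] yy'(1,2) equivalent_jn[OF xx'(1) yy'(1) xy] yy'(3)])
  show "x \<and>\<^sub>l y \<sim> x'"
    by (rule equivalent_trans[OF mt_closed[OF xx'(1) yy'(1)] xx'(1,2) equivalent_mt[OF xx'(1) yy'(1) xy] xx'(3)])
qed

end

lemma in_variety_l_group: "in_variety V H \<Longrightarrow> l_group H"
  by (cases V) (auto simp: representable_def)

lemma (in l_group) transport_l_hom: "inj_on c (carrier G) \<Longrightarrow> c \<in> l_hom G (transport c G (carrier G))"
proof -
  assume c: "inj_on c (carrier G)"
  interpret G: sub_l_group G "carrier G" by (rule sub_l_group_carrier)
  have "l_group G" by unfold_locales
  then show ?thesis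
    by (rule l_homI[OF _ G.l_group_transport[OF c]])
      (auto simp: G.transport_jn[OF c] G.transport_carrier[OF c] G.transport_mult[OF c] intro!: homI)
qed

section \<open>Free lattice-ordered groups: generation and lifting of preorders\<close>

locale free_l_group = G: po_group G + F: l_group F
  for G :: "'g pogroup" and F :: "'f pogroup" +
  fixes V :: variety and \<eta> :: "'g \<Rightarrow> 'f"
  assumes free: "free_l_group_over V G F \<eta>"
begin

lemma in_V: "in_variety V F" and \<eta>_positive: "\<eta> \<in> positive_hom G F"
  using free by (auto simp: free_l_group_over_def)

sublocale \<eta>: group_hom G F \<eta>
  using \<eta>_positive by unfold_locales (simp add: positive_hom_def)

lemma \<eta>_leq: "\<lbrakk>x \<in> carrier G; y \<in> carrier G; x \<preceq>\<^bsub>G\<^esub> y\<rbrakk> \<Longrightarrow> \<eta> x \<preceq>\<^bsub>F\<^esub> \<eta> y"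
  by (rule positive_hom_leq[OF \<eta>_positive])

lemma F_l_group: "l_group F"
  by unfold_locales

lemma extend:
  fixes H :: "('g, 'f) test pogroup"
  assumes "in_variety V H" "p \<in> positive_hom G H"
  obtains h where "h \<in> l_hom F H" "\<And>x. x \<in> carrier G \<Longrightarrow> h (\<eta> x) = p x"
  using free assms unfolding free_l_group_over_def by blast

text \<open>Uniqueness is available for extensional maps; restricting \<open>h\<close> and
  \<open>k\<close> to the carrier brings them into this form.\<close>

lemma extend_unique:
  fixes H :: "('g, 'f) test pogroup"
  assumes H: "in_variety V H" and p: "(\<lambda>x. h (\<eta> x)) \<in> positive_hom G H"
    and h: "h \<in> l_hom F H" and k: "k \<in> l_hom F H"
    and eq: "\<And>x. x \<in> carrier G \<Longrightarrow> h (\<eta> x) = k (\<eta> x)"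
    and x: "x \<in> carrier F"
  shows "h x = k x"
proof -
  define P where "P f \<longleftrightarrow> f \<in> l_hom F H \<inter> extensional (carrier F) \<and> (\<forall>x\<in>carrier G. f (\<eta> x) = h (\<eta> x))" for f
  have ex: "\<exists>!f. P f"
    using free H p unfolding free_l_group_over_def P_def by blast
  have "P (restrict h (carrier F))" "P (restrict k (carrier F))"
    using l_hom_cong[OF F_l_group h, of "restrict h (carrier F)"]
      l_hom_cong[OF F_l_group k, of "restrict k (carrier F)"] eq
    by (simp_all add: P_def)
  then have "restrict h (carrier F) = restrict k (carrier F)" using the1_equality[OF ex] by metis
  then show ?thesis using x by (metis restrict_apply')
qed

text \<open>
  By freeness, \<open>F\<close> maps to the sublattice \<open>L\<close> generated by \<open>\<eta>(G)\<close>; followed by the inclusion of \<open>L\<close>, this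
  is the identity by uniqueness.
\<close>

lemma generated: "lattice_closure F (\<eta> ` carrier G) = carrier F"
proof
  let ?L = "lattice_closure F (\<eta> ` carrier G)"
  interpret L: sub_l_group F ?L
    by (rule F.sub_l_group_lattice_closure[OF \<eta>.img_is_subgroup])
  show "?L \<subseteq> carrier F" using L.MG by blast
  interpret F: sub_l_group F "carrier F" by (rule F.sub_l_group_carrier)
  \<comment> \<open>Elements of \<open>F\<close> become constant functions, which embeds
    \<open>F\<close> into the test type.\<close>
  let ?c = "\<lambda>x :: 'f. (\<lambda>_. Inr (Inl x)) :: 'g + 'f + nat \<Rightarrow> 'g + 'f + nat"
  have inj: "inj_on ?c X" for X by (auto simp: inj_on_def fun_eq_iff)
  let ?TL = "transport ?c F ?L" and ?TF = "transport ?c F (carrier F)"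
  note \<eta>L = lattice_closure.base[of _ "\<eta> ` carrier G" F]
  have "(\<lambda>x. ?c (\<eta> x)) \<in> positive_hom G ?TL"
    by (rule positive_homI[OF G.po_group_axioms L.po_group_transport[OF inj]])
      (auto simp: L.transport_carrier[OF inj] L.transport_mult[OF inj] L.transport_leq[OF inj] \<eta>L \<eta>_leq
        intro!: homI)
  then obtain h where h: "h \<in> l_hom F ?TL" "\<And>x. x \<in> carrier G \<Longrightarrow> h (\<eta> x) = ?c (\<eta> x)"
    using extend[OF L.in_variety_transport[OF inj in_V]] by blast
  have hL: "h x \<in> ?c ` ?L" if "x \<in> carrier F" for x
    using l_hom_closed[OF h(1) that] by (simp add: L.transport_carrier[OF inj])
  have c: "?c \<in> l_hom F ?TF" by (rule F.transport_l_hom[OF inj])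
  have pF: "(\<lambda>x. ?c (\<eta> x)) \<in> positive_hom G ?TF"
    by (rule positive_homI[OF G.po_group_axioms F.po_group_transport[OF inj]])
      (auto simp: F.transport_carrier[OF inj] F.transport_mult[OF inj] F.transport_leq[OF inj] \<eta>_leq
        intro!: homI)
  note TF = F.l_group_transport[OF inj] and TL = L.l_group_transport[OF inj]
  \<comment> \<open>Both copies use the same \<open>?c\<close>, so going back to \<open>F\<close>
    and on to \<open>?TF\<close> returns the values of \<open>h\<close>, which thus is a
    homomorphism into \<open>?TF\<close>.\<close>
  have "(\<lambda>x. ?c (inv_into ?L ?c (h x))) \<in> l_hom F ?TF"
    using l_hom_compose[OF F_l_group F_l_group TF l_hom_compose[OF F_l_group TL F_l_group h(1) L.inv_into_l_hom[OF inj]] c]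
    by simp
  then have "h \<in> l_hom F ?TF"
  proof (rule l_hom_cong[OF F_l_group])
    fix x assume "x \<in> carrier F"
    then show "?c (inv_into ?L ?c (h x)) = h x" by (rule f_inv_into_f[OF hL])
  qed
  then have "?c x = h x" if "x \<in> carrier F" for x
    by (intro extend_unique[OF F.in_variety_transport[OF inj in_V] pF c _ _ that]) (simp_all add: h)
  then have "?c x \<in> ?c ` ?L" if "x \<in> carrier F" for x using hL[OF that] that by metis
  then have "x \<in> ?L" if "x \<in> carrier F" for x
    using that inj_image_mem_iff[OF inj[of UNIV]] by metis
  then show "carrier F \<subseteq> ?L" by blast
qed

text \<open>Every element of \<open>F\<close> is equivalent to some \<open>\<eta> g\<close>, with
  respect to \<open>R\<close> and \<open>R'\<close> at once: at a join or meet \<open>R\<close>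
  selects one of two representatives, and by \<open>sub\<close> the relation \<open>R'\<close> makes
  the same selection.\<close>

lemma prime_preorder_mono:
  assumes R: "prime_preorder F R" and R': "prime_preorder F R'"
    and sub: "\<And>g h. \<lbrakk>g \<in> carrier G; h \<in> carrier G; R (\<eta> g) (\<eta> h)\<rbrakk> \<Longrightarrow> R' (\<eta> g) (\<eta> h)"
    and x: "x \<in> carrier F" and y: "y \<in> carrier F" and "R x y"
  shows "R' x y"
proof -
  interpret R: prime_preorder F R by fact
  interpret R': prime_preorder F R' by fact
  let ?rep = "\<lambda>x g. x \<in> carrier F \<and> g \<in> carrier G \<and> R.equivalent x (\<eta> g) \<and> R'.equivalent x (\<eta> g)"
  have step: "?rep (F.jn x y) h" "?rep (F.mt x y) g" if xg: "?rep x g" and yh: "?rep y h" and gh: "R (\<eta> g) (\<eta> h)" for x y g h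
    using xg yh gh sub[OF _ _ gh] R.equivalent_jn_mt[of x "\<eta> g" y "\<eta> h"] R'.equivalent_jn_mt[of x "\<eta> g" y "\<eta> h"]
    by (simp_all add: F.jn_closed F.mt_closed)
  have rep: "\<exists>g. ?rep x g" if "x \<in> lattice_closure F (\<eta> ` carrier G)" for x
    using that
  proof induction
    case (base x)
    then show ?case using R.R_refl R'.R_refl by auto
  next
    case (jn x y)
    then obtain g h where gh: "?rep x g" "?rep y h" by blast
    then have "R (\<eta> g) (\<eta> h) \<or> R (\<eta> h) (\<eta> g)" using R.R_total by simp
    then show ?case using step[OF gh] step[OF gh(2,1)] by (metis join_comm)
  next
    case (mt x y)
    then obtain g h where gh: "?rep x g" "?rep y h" by blast
    then have "R (\<eta> g) (\<eta> h) \<or> R (\<eta> h) (\<eta> g)" using R.R_total by simp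
    then show ?case using step[OF gh] step[OF gh(2,1)] by (metis meet_comm)
  qed
  obtain g h where g: "?rep x g" and h: "?rep y h" using rep generated x y by metis
  then show ?thesis
    using \<open>R x y\<close> sub[of g h] R.R_cong[of x y "\<eta> g" "\<eta> h"] R'.R_cong[of x y "\<eta> g" "\<eta> h"] by simp
qed

text \<open>Freeness extends the action of \<open>G\<close> on the chain of classes of
  \<open>S\<close> to \<open>F\<close>, and evaluation at a point is a prime preorder. The
  conditions \<open>left\<close> and \<open>comm\<close> place the image of \<open>G\<close> in the
  variety when the full automorphism group need not belong to it.\<close>

lemma right_preorder_lift:
  assumes S: "right_preorder G S"
    and left: "V \<noteq> All_l_groups \<Longrightarrow> left_invariant G S"
    and comm: "V = Abelian_l_groups \<Longrightarrow> (\<And>g h. \<lbrakk>g \<in> carrier G; h \<in> carrier G\<rbrakk> \<Longrightarrow> S (g \<otimes>\<^bsub>G\<^esub> h) (h \<otimes>\<^bsub>G\<^esub> g))"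
  obtains R where "prime_preorder F R"
    "\<And>g h. \<lbrakk>g \<in> carrier G; h \<in> carrier G\<rbrakk> \<Longrightarrow> R (\<eta> g) (\<eta> h) \<longleftrightarrow> S g h"
proof -
  interpret right_preorder G S by fact
  \<comment> \<open>A class is named by a chosen member, and \<open>Inl\<close> places it in the
    type underlying the test objects.\<close>
  let ?point = "\<lambda>g. Inl (SOME h. h \<in> carrier G \<and> S g h \<and> S h g) :: 'g + 'f + nat"
  interpret point_action G S ?point
  proof
    fix x y assume xy: "x \<in> carrier G" "y \<in> carrier G"
    have ex: "\<exists>h. h \<in> carrier G \<and> S g h \<and> S h g" if "g \<in> carrier G" for g
      using S_total[OF that that] that by blast
    show "?point x = ?point y \<longleftrightarrow> S x y \<and> S y x"
    proof
      assume "?point x = ?point y"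
      then have "(SOME h. h \<in> carrier G \<and> S x h \<and> S h x) = (SOME h. h \<in> carrier G \<and> S y h \<and> S h y)" by simp
      then obtain z where "z \<in> carrier G" "S x z" "S z x" "S y z" "S z y"
        using someI_ex[OF ex[OF xy(1)]] someI_ex[OF ex[OF xy(2)]] by metis
      then show "S x y \<and> S y x" using xy S_trans by blast
    next
      assume "S x y \<and> S y x"
      then have "h \<in> carrier G \<and> S x h \<and> S h x \<longleftrightarrow> h \<in> carrier G \<and> S y h \<and> S h y" for h
        using xy S_trans by blast
      then show "?point x = ?point y" by simp
    qed
  qed
  let ?A = "chain_aut points point_le"
  have "\<exists>h\<in>l_hom F ?A. \<forall>x\<in>carrier G. h (\<eta> x) = act x"
  proof (cases "V = All_l_groups")
    case True
    then have "in_variety V ?A" by (simp add: points.l_group_chain_aut)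
    then obtain h where "h \<in> l_hom F ?A" "\<And>x. x \<in> carrier G \<Longrightarrow> h (\<eta> x) = act x"
      using act_positive by (rule extend) (rule that)
    then show ?thesis by blast
  next
    case False
    \<comment> \<open>The image of \<open>G\<close> is totally ordered, which puts it into the variety.\<close>
    note left = left[OF False]
    let ?M = "act ` carrier G"
    interpret M: sub_l_group ?A ?M by (rule act_image_l_group(1)[OF left])
    have inj: "inj_on (\<lambda>f. f) ?M" by simp
    let ?H = "transport (\<lambda>f. f) ?A ?M"
    have o: "o_group ?H" by (rule act_image_l_group(2)[OF left])
    have mult: "act g \<otimes>\<^bsub>?H\<^esub> act h = act (g \<otimes>\<^bsub>G\<^esub> h)" if "g \<in> carrier G" "h \<in> carrier G" for g h
      using that M.transport_mult[OF inj] act_hom by (simp add: hom_def)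
    have "comm_group ?H" if "V = Abelian_l_groups"
    proof -
      have "?point (x \<otimes>\<^bsub>G\<^esub> (g \<otimes>\<^bsub>G\<^esub> h)) = ?point (x \<otimes>\<^bsub>G\<^esub> (h \<otimes>\<^bsub>G\<^esub> g))"
        if "x \<in> carrier G" "g \<in> carrier G" "h \<in> carrier G" for x g h
        using that comm[OF \<open>V = Abelian_l_groups\<close>] left
        by (subst point_eq_iff) (simp_all add: left_invariant_def)
      then have "act (g \<otimes>\<^bsub>G\<^esub> h) = act (h \<otimes>\<^bsub>G\<^esub> g)" if "g \<in> carrier G" "h \<in> carrier G" for g h
        using that by (intro act_eqI) auto
      then show ?thesis
        using M.po_group_transport[OF inj] unfolding po_group_def
        by (intro group.group_comm_groupI) (auto simp: M.transport_carrier[OF inj] mult)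
    qed
    then have "in_variety V ?H"
      using False o_group_l_group[OF o] representable_o_group[OF o] by (cases V) auto
    moreover have "act \<in> positive_hom G ?H"
      by (rule positive_homI[OF G.po_group_axioms M.po_group_transport[OF inj]])
        (use positive_hom_leq[OF act_positive] in
          \<open>auto simp: M.transport_carrier[OF inj] mult M.transport_leq[OF inj] intro!: homI\<close>)
    ultimately obtain h where h: "h \<in> l_hom F ?H" "\<And>x. x \<in> carrier G \<Longrightarrow> h (\<eta> x) = act x"
      by (rule extend) (rule that)
    \<comment> \<open>Including the image of \<open>G\<close> into \<open>?A\<close> makes
      evaluation at points available in this case too.\<close>
    have l: "(\<lambda>x. inv_into ?M (\<lambda>f. f) (h x)) \<in> l_hom F ?A"
      by (rule l_hom_compose[OF F_l_group M.l_group_transport[OF inj] points.l_group_chain_aut h(1) M.inv_into_l_hom[OF inj]])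
    have "inv_into ?M (\<lambda>f. f) (h (\<eta> x)) = act x" if "x \<in> carrier G" for x
      using inv_into_f_f[OF inj, of "act x"] h(2)[OF that] that by simp
    then show ?thesis by (intro bexI[OF _ l] ballI)
  qed
  then obtain h where h: "h \<in> l_hom F ?A" "\<forall>x\<in>carrier G. h (\<eta> x) = act x" by (elim bexE)
  \<comment> \<open>The action of \<open>g\<close> sends the class of the identity to the class of
    \<open>g\<close>, so comparison at this point restricts to \<open>S\<close>.\<close>
  let ?e = "?point \<one>\<^bsub>G\<^esub>"
  have e: "?e \<in> points" by (auto simp: points_def)
  show thesis
  proof (rule that)
    show "prime_preorder F (\<lambda>x y. point_le (h x ?e) (h y ?e))"
      by (rule prime_preorder_pullback[OF F_l_group points.prime_preorder_point[OF e] h(1)])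
    fix x y assume "x \<in> carrier G" "y \<in> carrier G"
    then show "point_le (h (\<eta> x) ?e) (h (\<eta> y) ?e) \<longleftrightarrow> S x y"
      using act_point[OF G.one_closed] by (simp add: h(2) point_le_iff)
  qed
qed

end

section \<open>Minimal primes\<close>

context l_group
begin

text \<open>For a left invariant prime preorder one of \<open>a\<close> and \<open>u\<close> is
  equivalent to their meet, the identity. If it is \<open>a\<close>, invariance on both sides passes
  this on to the conjugate. So no such preorder separates the new meet from the identity. In the
  Abelian case conjugation does nothing.\<close>

lemma conj_orthogonal:
  assumes V: "in_variety V G" "V \<noteq> All_l_groups"
    and a: "a \<in> carrier G" "\<one> \<preceq> a" and u: "u \<in> carrier G" "\<one> \<preceq> u" and g: "g \<in> carrier G"
    and au: "a \<and>\<^sub>l u = \<one>"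
  shows "(g \<otimes> a \<otimes> inv g) \<and>\<^sub>l u = \<one>"
proof (cases V)
  case Abelian_l_groups
  then have "comm_group G" using V by simp
  then have "g \<otimes> a = a \<otimes> g" using a g by (simp add: comm_monoid.m_comm comm_group_def)
  then show ?thesis using a g au by (simp add: m_assoc)
next
  case Representable_l_groups
  then have rep: "\<forall>x\<in>carrier G. x \<noteq> \<one> \<longrightarrow> (\<exists>R. prime_preorder G R \<and> left_invariant G R \<and> x \<notin> preorder_ker G R)"
    using V(1) representable_iff[of G] by simp
  let ?b = "g \<otimes> a \<otimes> inv g"
  let ?m = "?b \<and>\<^sub>l u"
  have b: "?b \<in> carrier G" using a g by simp
  have m: "?m \<in> carrier G" using b u by (simp add: mt_closed)
  have "g \<otimes> \<one> \<otimes> inv g \<preceq> ?b" using a g by (intro translate) auto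
  then have "\<one> \<preceq> ?b" using g by simp
  then have pos: "\<one> \<preceq> ?m" using b u by (intro mt_greatest) auto
  show ?thesis
  proof (rule ccontr)
    assume "?m \<noteq> \<one>"
    then obtain R where R: "prime_preorder G R" "left_invariant G R" "?m \<notin> preorder_ker G R"
      using rep m by blast
    interpret prime_preorder G R by fact
    have left: "R (z \<otimes> x) (z \<otimes> y)" if "x \<in> carrier G" "y \<in> carrier G" "z \<in> carrier G" "R x y" for x y z
      using R(2) that by (simp add: left_invariant_def)
    have "R ?m \<one>"
    proof (cases "R a u")
      case True
      then have "R a \<one>" using equivalent_mt[OF a(1) u(1)] au by simp
      then have "R (g \<otimes> a) (g \<otimes> \<one>)" using a g by (intro left) auto
      then have "R ?b (g \<otimes> inv g)" using a g R_mult[of "g \<otimes> a" g "inv g"] by simp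
      then show ?thesis
        using R_leq[OF m b mt_left[OF b u(1)]] R_trans[of ?m ?b \<one>] b m g by simp
    next
      case False
      then have "R u a" using R_total a u by blast
      then have "R u \<one>" using equivalent_mt[OF u(1) a(1)] au by (simp add: meet_comm)
      then show ?thesis
        using R_leq[OF m u(1) mt_right[OF b u(1)]] R_trans[of ?m u \<one>] u m by simp
    qed
    then show False using R(3) m R_leq[OF _ m pos] by (simp add: preorder_ker_def)
  qed
qed (use V in simp)

text \<open>Used with two filters: a single positive element, to separate it from the identity, and
  the positive complement of a prime, to obtain a kernel inside that prime.\<close>

lemma preorder_omitting:
  assumes V: "in_variety V G" and A: "pos_filter A" "A \<noteq> {}"
  obtains R where "prime_preorder G R" "V \<noteq> All_l_groups \<longrightarrow> left_invariant G R"
    "A \<inter> preorder_ker G R = {}"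
proof -
  obtain U where U: "A \<subseteq> U" "pos_filter U" and max: "\<And>X. \<lbrakk>pos_filter X; U \<subseteq> X\<rbrakk> \<Longrightarrow> X = U"
    using pos_filter_extend[OF A(1)] by metis
  have "U \<noteq> {}" using U(1) A(2) by blast
  show thesis
  proof (rule that)
    show "prime_preorder G (filter_le U)"
      by (rule prime_preorder_filter_le[OF U(2) \<open>U \<noteq> {}\<close> max])
    show "V \<noteq> All_l_groups \<longrightarrow> left_invariant G (filter_le U)"
      using left_invariant_filter_le[OF U(2)] conj_orthogonal[OF V] by blast
    show "A \<inter> preorder_ker G (filter_le U) = {}"
      using pos_filter_omitted[OF U(2)] U(1) by blast
  qed
qed

text \<open>One of the positive parts of \<open>x\<close> and \<open>inv x\<close> differs from the
  identity and forms a filter by itself; a kernel omitting it omits \<open>x\<close>.\<close>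

lemma preorder_separating:
  assumes V: "in_variety V G" and x: "x \<in> carrier G" "x \<noteq> \<one>"
  obtains R where "prime_preorder G R" "V \<noteq> All_l_groups \<longrightarrow> left_invariant G R"
    "x \<notin> preorder_ker G R"
proof -
  have conv: "convex_l_subgroup {\<one>} G"
    unfolding convex_l_subgroup_def by (auto simp: triv_subgroup jn_absorb mt_absorb leq_refl intro: leq_antisym)
  obtain c where c: "c \<in> {x \<or>\<^sub>l \<one>, inv x \<or>\<^sub>l \<one>}" "c \<in> carrier G" "c \<notin> {\<one>}" "\<one> \<preceq> c"
    by (rule parts_not_in[OF conv x(1)]) (use x in auto)
  have "pos_filter {c}" using c by (auto simp: pos_filter_def mt_absorb leq_refl)
  then obtain R where R: "prime_preorder G R" "V \<noteq> All_l_groups \<longrightarrow> left_invariant G R"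
    "{c} \<inter> preorder_ker G R = {}"
    by (rule preorder_omitting[OF V]) simp
  have "x \<notin> preorder_ker G R"
    using parts_in[OF prime_preorder.convex_l_subgroup_ker[OF R(1)], of x] c(1) R(3) by auto
  then show thesis using that R by blast
qed

text \<open>The positive elements outside \<open>P\<close> form a filter, by
  \<open>prime_meet\<close>. A kernel omitting them lies in \<open>P\<close>, hence equals
  \<open>P\<close> by minimality. What is gained is left invariance in the representable and Abelian
  cases.\<close>

lemma minimal_prime_preorder:
  assumes V: "in_variety V G" and P: "P \<in> Min_Spec G"
  obtains R where "prime_preorder G R" "V \<noteq> All_l_groups \<longrightarrow> left_invariant G R"
    "preorder_ker G R = P"
proof -
  have prime: "prime_subgroup P G" using P by (simp add: Min_Spec_def Spec_def)
  have conv: "convex_l_subgroup P G" and proper: "P \<noteq> carrier G"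
    using prime unfolding prime_subgroup_def by blast+
  have sub: "subgroup P G" by (rule convex_subgroup[OF conv])
  let ?A = "{a \<in> carrier G. \<one> \<preceq> a \<and> a \<notin> P}"
  have filt: "pos_filter ?A"
    using prime_meet[OF prime] subgroup.one_closed[OF sub]
    by (auto simp: pos_filter_def mt_closed intro: mt_greatest)
  have "\<exists>x\<in>carrier G. x \<notin> P" using proper subgroup.subset[OF sub] by blast
  then have "?A \<noteq> {}" using parts_not_in[OF conv] by (metis (mono_tags, lifting) empty_iff mem_Collect_eq)
  then obtain R where R: "prime_preorder G R" "V \<noteq> All_l_groups \<longrightarrow> left_invariant G R"
    "?A \<inter> preorder_ker G R = {}"
    by (rule preorder_omitting[OF V filt])
  interpret prime_preorder G R by fact
  have "x \<in> P" if x: "x \<in> preorder_ker G R" for x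
  proof (rule ccontr)
    assume "x \<notin> P"
    moreover have "x \<in> carrier G" using x by (simp add: preorder_ker_def)
    ultimately obtain c where "c \<in> {x \<or>\<^sub>l \<one>, inv x \<or>\<^sub>l \<one>}" "c \<in> carrier G" "c \<notin> P" "\<one> \<preceq> c"
      using parts_not_in[OF conv] by blast
    then show False using parts_in[OF convex_l_subgroup_ker x] R(3) by auto
  qed
  then have "preorder_ker G R \<subseteq> P" by blast
  moreover have "preorder_ker G R \<in> Spec G"
    using prime_subgroup_ker calculation proper subgroup.subset[OF sub] by (auto simp: Spec_def)
  ultimately have "preorder_ker G R = P" using P by (auto simp: Min_Spec_def)
  then show thesis using that R by blast
qed

end

section \<open>Minimal primes of free lattice-ordered groups\<close>

context free_l_group
begin

text \<open>The refinement \<open>S\<close> is formed on \<open>G\<close>, where no joins have to be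
  respected, and then lifted. By \<open>prime_preorder_mono\<close> the lift implies
  \<open>R1\<close>, so its kernel lies in \<open>P\<close>; as it omits \<open>\<eta> c\<close>,
  this contradicts minimality.\<close>

lemma minimal_prime_Int_image:
  assumes P: "P \<in> Min_Spec F" and c: "c \<in> carrier G" and cP: "\<eta> c \<in> P"
  shows "\<eta> c = \<one>\<^bsub>F\<^esub>"
proof (rule ccontr)
  assume "\<eta> c \<noteq> \<one>\<^bsub>F\<^esub>"
  then obtain R2 where R2: "prime_preorder F R2" "V \<noteq> All_l_groups \<longrightarrow> left_invariant F R2"
    "\<eta> c \<notin> preorder_ker F R2"
    using c by (elim F.preorder_separating[OF in_V, rotated]) auto
  obtain R1 where R1: "prime_preorder F R1" "V \<noteq> All_l_groups \<longrightarrow> left_invariant F R1"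
    "preorder_ker F R1 = P"
    by (rule F.minimal_prime_preorder[OF in_V P])
  interpret R1: prime_preorder F R1 by fact
  interpret R2: prime_preorder F R2 by fact
  \<comment> \<open>the lexicographic refinement of \<open>R1\<close> by \<open>R2\<close>\<close>
  define S where "S g h \<longleftrightarrow> R1 (\<eta> g) (\<eta> h) \<and> (R1 (\<eta> h) (\<eta> g) \<longrightarrow> R2 (\<eta> g) (\<eta> h))" for g h
  \<comment> \<open>Translation has to respect the case distinction in \<open>S\<close>:
    \<open>R1\<close> between translates comes from \<open>R1\<close> between the elements
    themselves.\<close>
  have cancel: "R1 x y" if "R1 (x \<otimes>\<^bsub>F\<^esub> z) (y \<otimes>\<^bsub>F\<^esub> z)" "x \<in> carrier F" "y \<in> carrier F" "z \<in> carrier F" for x y z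
    using R1.R_mult[of "x \<otimes>\<^bsub>F\<^esub> z" "y \<otimes>\<^bsub>F\<^esub> z" "inv\<^bsub>F\<^esub> z"] that by (simp add: F.m_assoc)
  have pre: "right_preorder G S"
  proof
    fix x y assume xy: "x \<in> carrier G" "y \<in> carrier G"
    then show "S x y \<or> S y x" using R1.R_total R2.R_total unfolding S_def by (meson \<eta>.hom_closed)
    show "S x y" if "x \<preceq>\<^bsub>G\<^esub> y"
      using \<eta>_leq[OF xy that] R1.R_leq R2.R_leq xy by (simp add: S_def)
    fix z assume z: "z \<in> carrier G"
    show "S (x \<otimes>\<^bsub>G\<^esub> z) (y \<otimes>\<^bsub>G\<^esub> z)" if "S x y"
      using that xy z cancel[of "\<eta> y" "\<eta> z" "\<eta> x"] by (auto simp: S_def R1.R_mult R2.R_mult)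
    show "S x z" if "S x y" "S y z"
      using that R1.R_trans[of "\<eta> x" "\<eta> y" "\<eta> z"] R2.R_trans[of "\<eta> x" "\<eta> y" "\<eta> z"]
        R1.R_trans[of "\<eta> y" "\<eta> z" "\<eta> x"] R1.R_trans[of "\<eta> z" "\<eta> x" "\<eta> y"] xy z
      by (auto simp: S_def)
  qed
  have left: "left_invariant G S" if V: "V \<noteq> All_l_groups"
  proof -
    have l1: "R1 (z \<otimes>\<^bsub>F\<^esub> x) (z \<otimes>\<^bsub>F\<^esub> y)" if "R1 x y" "x \<in> carrier F" "y \<in> carrier F" "z \<in> carrier F" for x y z
      using R1(2) V that by (simp add: left_invariant_def)
    have l2: "R2 (z \<otimes>\<^bsub>F\<^esub> x) (z \<otimes>\<^bsub>F\<^esub> y)" if "R2 x y" "x \<in> carrier F" "y \<in> carrier F" "z \<in> carrier F" for x y z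
      using R2(2) V that by (simp add: left_invariant_def)
    have cancel_l: "R1 x y" if "R1 (z \<otimes>\<^bsub>F\<^esub> x) (z \<otimes>\<^bsub>F\<^esub> y)" "x \<in> carrier F" "y \<in> carrier F" "z \<in> carrier F" for x y z
      using l1[OF that(1), of "inv\<^bsub>F\<^esub> z"] that by (simp flip: F.m_assoc)
    show ?thesis
      unfolding left_invariant_def
    proof (intro ballI impI)
      fix x y z assume xyz: "x \<in> carrier G" "y \<in> carrier G" "z \<in> carrier G" and "S x y"
      then show "S (z \<otimes>\<^bsub>G\<^esub> x) (z \<otimes>\<^bsub>G\<^esub> y)"
        using cancel_l[of "\<eta> z" "\<eta> y" "\<eta> x"] by (simp add: S_def l1 l2)
    qed
  qed
  have comm: "S (g \<otimes>\<^bsub>G\<^esub> h) (h \<otimes>\<^bsub>G\<^esub> g)"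
    if V: "V = Abelian_l_groups" and gh: "g \<in> carrier G" "h \<in> carrier G" for g h
  proof -
    have "comm_group F" using in_V V by simp
    then have "\<eta> g \<otimes>\<^bsub>F\<^esub> \<eta> h = \<eta> h \<otimes>\<^bsub>F\<^esub> \<eta> g"
      using gh comm_monoid.m_comm[of F "\<eta> g" "\<eta> h"] by (simp add: comm_group_def)
    then show ?thesis using gh by (simp add: S_def R1.R_refl R2.R_refl)
  qed
  obtain R where R: "prime_preorder F R"
    "\<And>g h. \<lbrakk>g \<in> carrier G; h \<in> carrier G\<rbrakk> \<Longrightarrow> R (\<eta> g) (\<eta> h) \<longleftrightarrow> S g h"
    by (rule right_preorder_lift[OF pre left comm]) (assumption | rule that)+
  interpret R: prime_preorder F R by fact
  have "R1 x y" if "x \<in> carrier F" "y \<in> carrier F" "R x y" for x y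
    by (rule prime_preorder_mono[OF R(1) R1(1) _ that]) (simp add: R(2) S_def)
  then have sub: "preorder_ker F R \<subseteq> P"
    unfolding R1(3)[symmetric] by (auto simp: preorder_ker_def)
  have omit: "\<eta> c \<notin> preorder_ker F R"
  proof
    assume "\<eta> c \<in> preorder_ker F R"
    \<comment> \<open>Both comparisons then hold for \<open>R1\<close>, so \<open>S\<close> passes
      them on to \<open>R2\<close>, against the choice of \<open>R2\<close>.\<close>
    then have "S c \<one>\<^bsub>G\<^esub>" "S \<one>\<^bsub>G\<^esub> c" using R(2)[of c "\<one>\<^bsub>G\<^esub>"] R(2)[of "\<one>\<^bsub>G\<^esub>" c] c by (auto simp: preorder_ker_def)
    then show False using R2(3) c by (simp add: S_def preorder_ker_def)
  qed
  then have "preorder_ker F R \<noteq> carrier F" using \<eta>.hom_closed[OF c] by blast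
  then have "preorder_ker F R \<in> Spec F" unfolding Spec_def by (simp add: R.prime_subgroup_ker)
  then have "preorder_ker F R = P" using P sub by (simp add: Min_Spec_def)
  then show False using cP omit by simp
qed

text \<open>The preorder of a prime \<open>Q\<close> inside the kernel is contained in
  \<open>R\<close>. On the image of \<open>\<eta>\<close> the relation \<open>R\<close> is
  antisymmetric, so the total preorder of \<open>Q\<close> agrees with it there, and
  \<open>prime_preorder_mono\<close> carries this over to \<open>F\<close>.\<close>

lemma ker_minimal:
  assumes nontrivial: "carrier F \<noteq> {\<one>\<^bsub>F\<^esub>}" and R: "prime_preorder F R"
    and ker: "\<And>g. \<lbrakk>g \<in> carrier G; \<eta> g \<in> preorder_ker F R\<rbrakk> \<Longrightarrow> \<eta> g = \<one>\<^bsub>F\<^esub>"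
  shows "preorder_ker F R \<in> Min_Spec F"
proof -
  interpret R: prime_preorder F R by fact
  \<comment> \<open>If the kernel were all of \<open>F\<close>, then \<open>\<eta>\<close> would be
    trivial, and its image would generate only the identity.\<close>
  have "preorder_ker F R \<noteq> carrier F"
  proof
    assume "preorder_ker F R = carrier F"
    then have "\<eta> ` carrier G = {\<one>\<^bsub>F\<^esub>}" using ker G.one_closed \<eta>.hom_one by fastforce
    moreover have "x = \<one>\<^bsub>F\<^esub>" if "x \<in> lattice_closure F {\<one>\<^bsub>F\<^esub>}" for x
      using that by induction (auto simp: F.jn_absorb F.mt_absorb F.leq_refl)
    ultimately show False using generated nontrivial F.one_closed by auto
  qed
  then have spec: "preorder_ker F R \<in> Spec F" using R.prime_subgroup_ker by (simp add: Spec_def)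
  have "Q = preorder_ker F R" if Q: "Q \<in> Spec F" "Q \<subseteq> preorder_ker F R" for Q
  proof
    have Qp: "prime_subgroup Q F" using Q by (simp add: Spec_def)
    have pre: "prime_preorder F (coset_le F Q)" by (rule F.prime_preorder_coset_le[OF Qp])
    interpret Q: prime_preorder F "coset_le F Q" by fact
    have QR: "R x y" if "x \<in> carrier F" "y \<in> carrier F" "coset_le F Q x y" for x y
      using that Q(2) R.coset_le_ker[of x y] by (auto simp: coset_le_def)
    have "coset_le F Q (\<eta> g) (\<eta> h)" if gh: "g \<in> carrier G" "h \<in> carrier G" "R (\<eta> g) (\<eta> h)" for g h
    proof (rule ccontr)
      assume n: "\<not> ?thesis"
      then have "coset_le F Q (\<eta> h) (\<eta> g)" using Q.R_total[of "\<eta> g" "\<eta> h"] gh by simp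
      then have "R (\<eta> h) (\<eta> g)" using QR gh by simp
      then have "\<eta> (g \<otimes>\<^bsub>G\<^esub> inv\<^bsub>G\<^esub> h) \<in> preorder_ker F R"
        using R.equivalent_iff_ker[of "\<eta> g" "\<eta> h"] gh by simp
      then have "\<eta> g \<otimes>\<^bsub>F\<^esub> inv\<^bsub>F\<^esub> \<eta> h = \<one>\<^bsub>F\<^esub>" using ker[of "g \<otimes>\<^bsub>G\<^esub> inv\<^bsub>G\<^esub> h"] gh by simp
      then have "\<eta> g = \<eta> h" using gh F.inv_equality[of "\<eta> g" "inv\<^bsub>F\<^esub> \<eta> h"] by simp
      then show False using n Q.R_refl gh by simp
    qed
    then have "coset_le F Q x y" if "x \<in> carrier F" "y \<in> carrier F" "R x y" for x y
      using prime_preorder_mono[OF R pre _ that] by blast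
    then have "preorder_ker F R \<subseteq> preorder_ker F (coset_le F Q)" by (auto simp: preorder_ker_def)
    then show "preorder_ker F R \<subseteq> Q"
      using F.preorder_ker_coset_le[OF F.prime_convex[OF Qp]] by simp
  qed (rule Q)
  then show ?thesis using spec by (simp add: Min_Spec_def)
qed

text \<open>For each single \<open>g\<close> the condition concerns only two values of
  \<open>R\<close>, which makes the set of these preorders closed.\<close>

lemma Min_Spec_eq:
  assumes "carrier F \<noteq> {\<one>\<^bsub>F\<^esub>}"
  shows "Min_Spec F = preorder_ker F ` {R. prime_preorder F R \<and>
    (\<forall>g\<in>carrier G. \<eta> g \<in> preorder_ker F R \<longrightarrow> \<eta> g = \<one>\<^bsub>F\<^esub>)}"
proof (intro equalityI subsetI)
  fix P assume P: "P \<in> Min_Spec F"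
  obtain R where "prime_preorder F R" "preorder_ker F R = P"
    by (rule F.minimal_prime_preorder[OF in_V P])
  then show "P \<in> preorder_ker F ` {R. prime_preorder F R \<and>
      (\<forall>g\<in>carrier G. \<eta> g \<in> preorder_ker F R \<longrightarrow> \<eta> g = \<one>\<^bsub>F\<^esub>)}"
    using minimal_prime_Int_image[OF P] by blast
qed (use ker_minimal[OF assms] in blast)

end

section \<open>Compactness\<close>

abbreviation cantor_space :: "('a \<Rightarrow> bool) topology" where
  "cantor_space \<equiv> product_topology (\<lambda>_. discrete_topology UNIV) UNIV"

lemma compact_cantor_space: "compact_space cantor_space"
  by (simp add: compact_space_product_topology compact_space_discrete_topology)

lemma topspace_cantor_space: "topspace cantor_space = UNIV"
  by (simp add: topspace_product_topology)

text \<open>Boolean combinations of finitely many values of \<open>f\<close> are of this kind;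
  universal quantifiers over parameters then still give closed sets, by
  \<open>closed_all\<close>.\<close>

definition clopen_pred :: "(('a \<Rightarrow> bool) \<Rightarrow> bool) \<Rightarrow> bool" where
  "clopen_pred P \<longleftrightarrow> openin cantor_space {f. P f} \<and> closedin cantor_space {f. P f}"

lemma clopen_pred_not: "clopen_pred P \<Longrightarrow> clopen_pred (\<lambda>f. \<not> P f)"
proof -
  assume "clopen_pred P"
  then have "openin cantor_space (topspace cantor_space - {f. P f})"
    "closedin cantor_space (topspace cantor_space - {f. P f})"
    unfolding clopen_pred_def by blast+
  moreover have "topspace cantor_space - {f. P f} = {f. \<not> P f}" by (auto simp: topspace_cantor_space)
  ultimately show "clopen_pred (\<lambda>f. \<not> P f)" by (simp add: clopen_pred_def)
qed

lemma clopen_pred_conj: "\<lbrakk>clopen_pred P; clopen_pred Q\<rbrakk> \<Longrightarrow> clopen_pred (\<lambda>f. P f \<and> Q f)"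
  unfolding clopen_pred_def Collect_conj_eq by auto

lemma clopen_pred_disj: "\<lbrakk>clopen_pred P; clopen_pred Q\<rbrakk> \<Longrightarrow> clopen_pred (\<lambda>f. P f \<or> Q f)"
  unfolding clopen_pred_def Collect_disj_eq by auto

lemma clopen_pred_imp: "\<lbrakk>clopen_pred P; clopen_pred Q\<rbrakk> \<Longrightarrow> clopen_pred (\<lambda>f. P f \<longrightarrow> Q f)"
  unfolding imp_conv_disj by (intro clopen_pred_disj clopen_pred_not)

lemma clopen_pred_const: "clopen_pred (\<lambda>_. c)"
  unfolding clopen_pred_def using closedin_topspace[of cantor_space] openin_topspace[of cantor_space]
  by (cases c) (auto simp: topspace_cantor_space)

lemma clopen_pred_apply: "clopen_pred (\<lambda>f. f x)"
proof -
  have "continuous_map cantor_space (discrete_topology UNIV) (\<lambda>f :: 'a \<Rightarrow> bool. f x)"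
    by (rule continuous_map_product_projection) simp
  then have "openin cantor_space {f \<in> topspace cantor_space. f x \<in> {True}}"
    "closedin cantor_space {f \<in> topspace cantor_space. f x \<in> {True}}"
    by (rule openin_continuous_map_preimage closedin_continuous_map_preimage, simp)+
  then show ?thesis by (simp add: clopen_pred_def topspace_cantor_space)
qed

lemmas clopen_pred_intros = clopen_pred_imp clopen_pred_conj clopen_pred_disj clopen_pred_const clopen_pred_apply

lemma closed_clopen: "clopen_pred P \<Longrightarrow> closedin cantor_space {f. P f}"
  by (simp add: clopen_pred_def)

lemma closed_all: "(\<And>x. closedin cantor_space {f. P x f}) \<Longrightarrow> closedin cantor_space {f. \<forall>x. P x f}"
  unfolding Collect_all_eq by (rule closedin_INT) auto

lemma closed_conj:
  "\<lbrakk>closedin cantor_space {f. P f}; closedin cantor_space {f. Q f}\<rbrakk> \<Longrightarrow> closedin cantor_space {f. P f \<and> Q f}"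
  unfolding Collect_conj_eq by (rule closedin_Int)

text \<open>The \<open>l_group\<close> part does not depend on \<open>f\<close>, and for fixed
  elements each axiom is a Boolean combination of values of \<open>f\<close>.\<close>

lemma closed_prime_preorder: "closedin cantor_space {f. prime_preorder H (\<lambda>x y. f (x, y))}"
  unfolding prime_preorder_def prime_preorder_axioms_def
  by (intro closed_conj closed_all closed_clopen clopen_pred_intros)

text \<open>Primes are proper, so the open set given by \<open>A = carrier G\<close> is all of
  \<open>Spec G\<close>.\<close>

lemma (in l_group) topspace_min_spec: "topspace (min_spec_topology G) = Min_Spec G"
proof -
  have "{P \<in> Spec G. \<not> carrier G \<subseteq> P} = Spec G"
    by (auto simp: Spec_def prime_subgroup_def dest: convex_subgroup subgroup.subset)
  then have "openin (spec_topology G) (Spec G)"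
    unfolding openin_spec_topology by (metis order_refl)
  then have "Spec G \<subseteq> topspace (spec_topology G)" by (rule openin_subset)
  then show ?thesis by (auto simp: min_spec_topology_def topspace_subtopology Min_Spec_def)
qed

lemma (in free_l_group) compact_min_spec: "compact_space (min_spec_topology F)"
proof (cases "carrier F = {\<one>\<^bsub>F\<^esub>}")
  case True
  \<comment> \<open>The trivial group has no proper subgroup, so the space is empty. This case is
    split off because \<open>Min_Spec_eq\<close> assumes that \<open>F\<close> is
    nontrivial.\<close>
  have "P = carrier F" if "convex_l_subgroup P F" for P
    using subgroup.one_closed[OF F.convex_subgroup[OF that]] subgroup.subset[OF F.convex_subgroup[OF that]]
    unfolding True by auto
  then have "Spec F = {}" by (auto simp: Spec_def prime_subgroup_def)
  then show ?thesis
    unfolding compact_space_def F.topspace_min_spec by (simp add: Min_Spec_def)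
next
  case False
  \<comment> \<open>Relations are uncurried to become points of \<open>cantor_space\<close>. The set
    is that of \<open>Min_Spec_eq\<close>, with membership in the kernel unfolded into two values of
    \<open>f\<close>.\<close>
  let ?X = "{f. prime_preorder F (\<lambda>x y. f (x, y)) \<and>
    (\<forall>g. g \<in> carrier G \<longrightarrow> \<eta> g \<in> carrier F \<and> f (\<eta> g, \<one>\<^bsub>F\<^esub>) \<and> f (\<one>\<^bsub>F\<^esub>, \<eta> g) \<longrightarrow> \<eta> g = \<one>\<^bsub>F\<^esub>)}"
  let ?\<kappa> = "\<lambda>f. preorder_ker F (\<lambda>x y. f (x, y))"
  have "closedin cantor_space ?X"
    by (intro closed_conj closed_prime_preorder closed_all closed_clopen clopen_pred_intros)
  then have compact: "compactin cantor_space ?X"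
    by (rule closedin_compact_space[OF compact_cantor_space])
  have Min: "Min_Spec F = ?\<kappa> ` ?X"
  proof -
    have "{R. \<Phi> R} = (\<lambda>f x y. f (x, y)) ` {f. \<Phi> (\<lambda>x y. f (x, y))}" for \<Phi> :: "('f \<Rightarrow> 'f \<Rightarrow> bool) \<Rightarrow> bool"
    proof (intro equalityI subsetI)
      fix R assume "R \<in> {R. \<Phi> R}"
      then show "R \<in> (\<lambda>f x y. f (x, y)) ` {f. \<Phi> (\<lambda>x y. f (x, y))}"
        by (intro image_eqI[of _ _ "\<lambda>(x, y). R x y"]) auto
    qed auto
    then show ?thesis
      unfolding Min_Spec_eq[OF False] by (simp add: image_image preorder_ker_def Ball_def)
  qed
  have "continuous_map (subtopology cantor_space ?X) (min_spec_topology F) ?\<kappa>"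
    unfolding continuous_map_def
  proof (intro conjI allI impI)
    show "?\<kappa> \<in> topspace (subtopology cantor_space ?X) \<rightarrow> topspace (min_spec_topology F)"
      unfolding F.topspace_min_spec Min by (auto simp: topspace_subtopology topspace_cantor_space)
    fix U assume "openin (min_spec_topology F) U"
    then obtain A where A: "A \<subseteq> carrier F" "U = {P \<in> Spec F. \<not> A \<subseteq> P} \<inter> Min_Spec F"
      unfolding min_spec_topology_def openin_subtopology F.openin_spec_topology by blast
    \<comment> \<open>The kernel omits \<open>a\<close> iff one of the comparisons of
      \<open>a\<close> with the identity fails, a clopen condition; the union over \<open>A\<close>
      is therefore open.\<close>
    let ?W = "\<Union>a\<in>A. {f. \<not> (f (a, \<one>\<^bsub>F\<^esub>) \<and> f (\<one>\<^bsub>F\<^esub>, a))}"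
    have "clopen_pred (\<lambda>f. \<not> (f (a, \<one>\<^bsub>F\<^esub>) \<and> f (\<one>\<^bsub>F\<^esub>, a)))" for a
      by (intro clopen_pred_not clopen_pred_intros)
    then have "openin cantor_space ?W" by (intro openin_Union) (auto simp: clopen_pred_def)
    moreover have "{f \<in> topspace (subtopology cantor_space ?X). ?\<kappa> f \<in> U} = ?W \<inter> ?X"
    proof -
      have "?\<kappa> f \<in> U \<longleftrightarrow> f \<in> ?W" if "f \<in> ?X" for f
      proof -
        have "?\<kappa> f \<in> Min_Spec F" using that unfolding Min by blast
        moreover from this have "?\<kappa> f \<in> Spec F" by (simp add: Min_Spec_def)
        ultimately show ?thesis using A(1) unfolding A(2) by (auto simp: preorder_ker_def)
      qed
      then show ?thesis by (auto simp: topspace_subtopology topspace_cantor_space)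
    qed
    ultimately show "openin (subtopology cantor_space ?X) {f \<in> topspace (subtopology cantor_space ?X). ?\<kappa> f \<in> U}"
      unfolding openin_subtopology by blast
  qed
  moreover have "compactin (subtopology cantor_space ?X) ?X"
    using compact by (simp add: compactin_subtopology)
  ultimately have "compactin (min_spec_topology F) (?\<kappa> ` ?X)"
    by (intro image_compactin)
  then show ?thesis unfolding compact_space_def F.topspace_min_spec Min .
qed

theorem theorem7p2:
  fixes V :: variety and G :: "'g pogroup" and F :: "'f pogroup" and \<eta> :: "'g \<Rightarrow> 'f"
  assumes "po_group G"
    and "free_l_group_over V G F \<eta>"
  shows "compact_space (min_spec_topology F)"
proof -
  have "l_group F" using assms(2) in_variety_l_group by (auto simp: free_l_group_over_def)
  then interpret free_l_group G F V \<eta>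
    using assms by (simp add: free_l_group_def free_l_group_axioms_def)
  show ?thesis by (rule compact_min_spec)
qed

end
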